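(* For every positive integer $n$, $$|D(n)|=\sum_{N\in I_e(n)}\ \sum_{k=1}^{n-1}|P(N-k-n+1,\,k-1,\,n-1,\,n-k-1)|,$$ where $I_e(n)=\{N : n\le N\le n(n-1),\ N \text{ an even integer}\}$. Moreover, there is an algorithm which, given a positive integer $n$, computes $|D(n)|$ in time $O(n^5)$ and space $O(n^5)$.
   Context: All graphs are finite, simple (no loops or multiple edges) and undirected. Degree sequences are unordered (i.e. regarded as multisets, written in non-increasing order). $D(n)$ is the set of zero-free degree sequences of length $n$: those sequences $d_1\ge d_2\ge\dots\ge d_n\ge 1$ of positive integers that are the vertex degrees of some graph on $n$ vertices. A partition of an integer $N\ge 0$ is a non-increasing sequence of positive integers (parts) with sum $N$ (the empty partition is the only partition of $0$). For a partition $\pi$, $\pi_i$ and $\pi_i'$ denote the number of dots in the $i$-th row and the $i$-th column of its Ferrers diagram (so $\pi_i$ is the $i$-th part and $\pi'$ is the conjugate partition), $d(\pi)$ is the size (number of rows) of its Durfee square, i.e. of the largest upper-left square contained in its Ferrers diagram, and $r_i(\pi)=\pi_i'-\pi_i$ for $1\le i\le d(\pi)$. $P(N,k,l)$ is the set of partitions of $N$ into at most $l$ parts with largest part at most $k$ (empty if $N<0$, $k<0$ or $l<0$). For an integer $s$, $P(N,k,l,s)=\emptyset$ if $s<0$, and if $s\ge 0$, $$P(N,k,l,s)=\Big\{\pi\in P(N,k,l) : s+\sum_{i=1}^{j}r_i(\pi)\ge j \text{ for all } 1\le j\le d(\pi)\Big\}.$$ Cost model: time is the number of elementary operations (additions,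 subtractions and comparisons of integers, array accesses), each of unit cost; space is the number of integers stored. *)

theory Defs
  imports Complex_Main "HOL-Library.Multiset" "HOL-Library.Landau_Symbols"
begin

section \<open>Degree sequences of simple graphs\<close>

definition simple_graph :: "'a set \<Rightarrow> 'a set set \<Rightarrow> bool" where
  "simple_graph V E \<longleftrightarrow> finite V \<and> (\<forall>e\<in>E. e \<subseteq> V \<and> card e = 2)"

definition vertex_degree :: "'a set set \<Rightarrow> 'a \<Rightarrow> nat" where
  "vertex_degree E v = card {e \<in> E. v \<in> e}"

definition degree_multiset :: "'a set \<Rightarrow> 'a set set \<Rightarrow> nat multiset" where
  "degree_multiset V E = image_mset (vertex_degree E) (mset_set V)"

text \<open>Vertices are natural numbers; up to isomorphism this covers every finite graph.\<close>

definition D :: "nat \<Rightarrow> nat list set" where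
  "D n = {ds. length ds = n \<and> sorted_wrt (\<ge>) ds \<and> (\<forall>d\<in>set ds. d \<ge> 1) \<and>
     (\<exists>(V :: nat set) E. simple_graph V E \<and> card V = n \<and> mset ds = degree_multiset V E)}"


section \<open>Partitions\<close>

definition is_partition :: "nat list \<Rightarrow> bool" where
  "is_partition \<pi> \<longleftrightarrow> sorted_wrt (\<ge>) \<pi> \<and> (\<forall>p\<in>set \<pi>. p \<ge> 1)"

text \<open>Rows and columns of the Ferrers diagram are numbered from 1, list positions from 0.\<close>

definition ferrers :: "nat list \<Rightarrow> (nat \<times> nat) set" where
  "ferrers \<pi> = {(i, j). 1 \<le> i \<and> i \<le> length \<pi> \<and> 1 \<le> j \<and> j \<le> \<pi> ! (i - 1)}"

definition row_size :: "nat list \<Rightarrow> nat \<Rightarrow> nat" where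
  "row_size \<pi> i = card {j. (i, j) \<in> ferrers \<pi>}"

definition col_size :: "nat list \<Rightarrow> nat \<Rightarrow> nat" where
  "col_size \<pi> j = card {i. (i, j) \<in> ferrers \<pi>}"

definition durfee :: "nat list \<Rightarrow> nat" where
  "durfee \<pi> = Max {m. {1..m} \<times> {1..m} \<subseteq> ferrers \<pi>}"

definition rank_at :: "nat list \<Rightarrow> nat \<Rightarrow> int" where
  "rank_at \<pi> i = int (col_size \<pi> i) - int (row_size \<pi> i)"

text \<open>The bound \<open>0 \<le> k\<close> is not redundant: the empty partition has no part exceeding a
  negative \<open>k\<close>.\<close>

definition P :: "int \<Rightarrow> int \<Rightarrow> int \<Rightarrow> nat list set" where
  "P N k l = {\<pi>. 0 \<le> N \<and> 0 \<le> k \<and> 0 \<le> l \<and> is_partition \<pi> \<and> int (sum_list \<pi>) = N \<and>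
     int (length \<pi>) \<le> l \<and> (\<forall>p\<in>set \<pi>. int p \<le> k)}"

definition Ps :: "int \<Rightarrow> int \<Rightarrow> int \<Rightarrow> int \<Rightarrow> nat list set" where
  "Ps N k l s =
     (if s < 0 then {}
      else {\<pi> \<in> P N k l. \<forall>j\<in>{1..durfee \<pi>}. s + (\<Sum>i=1..j. rank_at \<pi> i) \<ge> int j})"

definition I_even :: "nat \<Rightarrow> int set" where
  "I_even n = {N. int n \<le> N \<and> N \<le> int n * (int n - 1) \<and> even N}"


section \<open>Algorithms with unit-cost integer operations\<close>

text \<open>
  Algorithms are structured programs over integer-valued scalars and arrays. A storage cell is
  an array name with the tuple of its indices; a scalar is an array with the empty index tuple.
  The number of indices in each array reference is fixed by the program text. Multiplication is
  not an operation of the language.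
\<close>

type_synonym cell = "string \<times> int list"
type_synonym state = "cell \<Rightarrow> int"

datatype expr =
    Const int
  | Read string "expr list"
  | Add expr expr
  | Sub expr expr

datatype test = Less expr expr | Equal expr expr

datatype prog =
    Skip
  | Store string "expr list" expr
  | Seq prog prog
  | Branch test prog prog
  | While test prog

fun expr_val :: "expr \<Rightarrow> state \<Rightarrow> int" where
  "expr_val (Const c) \<sigma> = c"
| "expr_val (Read a es) \<sigma> = \<sigma> (a, map (\<lambda>e. expr_val e \<sigma>) es)"
| "expr_val (Add e f) \<sigma> = expr_val e \<sigma> + expr_val f \<sigma>"
| "expr_val (Sub e f) \<sigma> = expr_val e \<sigma> - expr_val f \<sigma>"

text \<open>Accesses to scalars are charged like array accesses.\<close>

fun expr_cost :: "expr \<Rightarrow> nat" where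
  "expr_cost (Const c) = 0"
| "expr_cost (Read a es) = 1 + (\<Sum>e\<leftarrow>es. expr_cost e)"
| "expr_cost (Add e f) = 1 + expr_cost e + expr_cost f"
| "expr_cost (Sub e f) = 1 + expr_cost e + expr_cost f"

fun expr_cells :: "expr \<Rightarrow> state \<Rightarrow> cell set" where
  "expr_cells (Const c) \<sigma> = {}"
| "expr_cells (Read a es) \<sigma> =
     insert (a, map (\<lambda>e. expr_val e \<sigma>) es) (\<Union>e\<in>set es. expr_cells e \<sigma>)"
| "expr_cells (Add e f) \<sigma> = expr_cells e \<sigma> \<union> expr_cells f \<sigma>"
| "expr_cells (Sub e f) \<sigma> = expr_cells e \<sigma> \<union> expr_cells f \<sigma>"

fun test_val :: "test \<Rightarrow> state \<Rightarrow> bool" where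
  "test_val (Less e f) \<sigma> \<longleftrightarrow> expr_val e \<sigma> < expr_val f \<sigma>"
| "test_val (Equal e f) \<sigma> \<longleftrightarrow> expr_val e \<sigma> = expr_val f \<sigma>"

fun test_cost :: "test \<Rightarrow> nat" where
  "test_cost (Less e f) = 1 + expr_cost e + expr_cost f"
| "test_cost (Equal e f) = 1 + expr_cost e + expr_cost f"

fun test_cells :: "test \<Rightarrow> state \<Rightarrow> cell set" where
  "test_cells (Less e f) \<sigma> = expr_cells e \<sigma> \<union> expr_cells f \<sigma>"
| "test_cells (Equal e f) \<sigma> = expr_cells e \<sigma> \<union> expr_cells f \<sigma>"

text \<open>
  \<open>exec p \<sigma> t F \<tau>\<close>: started in \<open>\<sigma>\<close>, \<open>p\<close> terminates in \<open>\<tau>\<close> after \<open>t\<close> elementary operations,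
  and \<open>F\<close> is the set of all cells read or written on the way. The semantics is deterministic.
\<close>

inductive exec :: "prog \<Rightarrow> state \<Rightarrow> nat \<Rightarrow> cell set \<Rightarrow> state \<Rightarrow> bool" where
  exec_Skip: "exec Skip \<sigma> 0 {} \<sigma>"
| exec_Store:
    "c = (a, map (\<lambda>e. expr_val e \<sigma>) es) \<Longrightarrow>
     exec (Store a es e) \<sigma> (1 + (\<Sum>e\<leftarrow>es. expr_cost e) + expr_cost e)
       (insert c ((\<Union>e\<in>set es. expr_cells e \<sigma>) \<union> expr_cells e \<sigma>)) (\<sigma>(c := expr_val e \<sigma>))"
| exec_Seq:
    "exec p \<sigma> t F \<sigma>' \<Longrightarrow> exec q \<sigma>' u G \<tau> \<Longrightarrow> exec (Seq p q) \<sigma> (t + u) (F \<union> G) \<tau>"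
| exec_Branch_True:
    "test_val b \<sigma> \<Longrightarrow> exec p \<sigma> t F \<tau> \<Longrightarrow>
     exec (Branch b p q) \<sigma> (test_cost b + t) (test_cells b \<sigma> \<union> F) \<tau>"
| exec_Branch_False:
    "\<not> test_val b \<sigma> \<Longrightarrow> exec q \<sigma> t F \<tau> \<Longrightarrow>
     exec (Branch b p q) \<sigma> (test_cost b + t) (test_cells b \<sigma> \<union> F) \<tau>"
| exec_While_False:
    "\<not> test_val b \<sigma> \<Longrightarrow> exec (While b p) \<sigma> (test_cost b) (test_cells b \<sigma>) \<sigma>"
| exec_While_True:
    "test_val b \<sigma> \<Longrightarrow> exec p \<sigma> t F \<sigma>' \<Longrightarrow> exec (While b p) \<sigma>' u G \<tau> \<Longrightarrow>
     exec (While b p) \<sigma> (test_cost b + t + u) (test_cells b \<sigma> \<union> F \<union> G) \<tau>"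

definition input_state :: "nat \<Rightarrow> state" where
  "input_state n = (\<lambda>_. 0)((''in'', []) := int n)"

text \<open>
  One program serves all positive inputs; \<open>T n\<close> bounds its running time and \<open>S n\<close> the number of
  integers it ever stores, on input \<open>n\<close>.
\<close>

definition computes_within ::
    "prog \<Rightarrow> (nat \<Rightarrow> nat) \<Rightarrow> (nat \<Rightarrow> nat) \<Rightarrow> (nat \<Rightarrow> nat) \<Rightarrow> bool" where
  "computes_within p f T S \<longleftrightarrow>
     (\<forall>n\<ge>1. \<exists>t F \<tau>. exec p (input_state n) t F \<tau> \<and> \<tau> (''out'', []) = int (f n) \<and>
        t \<le> T n \<and> card F \<le> S n)"

end

theory Submission
  imports Defs
begin

text \<open>
  A multiset of positive integers is the degree sequence of a graph iff its sum is even and, as a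
  partition, it satisfies Nash-Williams' condition \<open>r\<^sub>1 + \<dots> + r\<^sub>j \<ge> j\<close> for all \<open>j\<close> up to the size of
  its Durfee square (\<open>graphic_iff\<close>, \<open>rank_cond_iff\<close>, \<open>D_eq\<close>). Written out with
  \<open>\<Sum>\<^sub>p min p j\<close> for the dots in the first \<open>j\<close> columns, this is the Erdos-Gallai criterion at those \<open>j\<close>.
  Necessity is a double count of edges (\<open>degree_sum_bound\<close>). For sufficiency the vertices are saturated
  one after the other by edge exchanges (\<open>improve_subrealization\<close>), which get stuck only in a
  configuration that violates the inequality.

  Removing the first row and the first column of a diagram lowers the Durfee square by one and turns
  the condition with slack \<open>s\<close> into the same condition with slack \<open>s + r\<^sub>1 - 1\<close>
  (\<open>rank_cond_add_hook\<close>). For the degree sequences of length \<open>n\<close> with largest degree \<open>k\<close> this is a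
  bijection onto the partitions in a box that satisfy the condition with slack \<open>n - k - 1\<close> and have
  the right parity, which proves the formula (\<open>card_D_Ps\<close>). Applied to partitions that fill both
  sides of their box, it gives the recurrence \<open>parity_count_rec\<close>.

  Since the size of a partition enters the formula only through its parity, the recurrence can be
  run on a table indexed by the two sides of the box, the slack and a parity. Slacks stay below
  \<open>n\<^sup>2\<close>, so the table has \<open>O(n\<^sup>4)\<close> entries of constant cost, well within the claimed bound
  (\<open>runs_count_D\<close>). Space is bounded by time (\<open>exec_space_le_time\<close>).
\<close>

section \<open>The Erdos-Gallai criterion inside the Durfee square\<close>

definition nbrs :: "'a set set \<Rightarrow> 'a \<Rightarrow> 'a set" where
  "nbrs E v = {u. {u, v} \<in> E}"

lemma simple_graph_finite_edges:
  assumes "simple_graph V E"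
  shows "finite E"
proof -
  have "E \<subseteq> Pow V" "finite (Pow V)" using assms by (auto simp: simple_graph_def)
  then show ?thesis by (rule finite_subset)
qed

lemma simple_graph_edge:
  assumes "simple_graph V E" "{u, v} \<in> E"
  shows "u \<in> V" "v \<in> V" "u \<noteq> v"
proof -
  have "{u, v} \<subseteq> V \<and> card {u, v} = 2" using assms unfolding simple_graph_def by blast
  then show "u \<in> V" "v \<in> V" by simp_all
  show "u \<noteq> v"
  proof
    assume "u = v"
    then have "card {u, v} = 1" by simp
    then show False using \<open>{u, v} \<subseteq> V \<and> card {u, v} = 2\<close> by simp
  qed
qed

lemma nbrs_subset: "simple_graph V E \<Longrightarrow> nbrs E v \<subseteq> V - {v}"
  by (auto simp: nbrs_def dest: simple_graph_edge)

lemma finite_nbrs: "simple_graph V E \<Longrightarrow> finite (nbrs E v)"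
  using nbrs_subset[of V E v] unfolding simple_graph_def by (meson finite_Diff finite_subset)

lemma nbrs_sym: "u \<in> nbrs E v \<longleftrightarrow> v \<in> nbrs E u"
  by (simp add: nbrs_def insert_commute)

lemma vertex_degree_nbrs:
  assumes "simple_graph V E"
  shows "vertex_degree E v = card (nbrs E v)"
proof -
  have "inj_on (\<lambda>u. {u, v}) (nbrs E v)"
    by (auto simp: inj_on_def doubleton_eq_iff)
  moreover have "(\<lambda>u. {u, v}) ` nbrs E v = {e \<in> E. v \<in> e}"
  proof
    show "{e \<in> E. v \<in> e} \<subseteq> (\<lambda>u. {u, v}) ` nbrs E v"
    proof
      fix e assume e: "e \<in> {e \<in> E. v \<in> e}"
      then have "card e = 2" using assms by (auto simp: simple_graph_def)
      then obtain x y where "e = {x, y}" by (auto simp: card_2_iff)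
      with e obtain u where "e = {u, v}" by auto
      with e show "e \<in> (\<lambda>u. {u, v}) ` nbrs E v" by (auto simp: nbrs_def)
    qed
  qed (auto simp: nbrs_def)
  ultimately show ?thesis
    unfolding vertex_degree_def by (metis card_image)
qed

lemma sum_degree_double_count:
  assumes "simple_graph V E" "K \<subseteq> V"
  shows "(\<Sum>v\<in>K. vertex_degree E v) = (\<Sum>u\<in>V. card (nbrs E u \<inter> K))"
proof -
  have V: "finite V" "finite K"
    using assms finite_subset by (auto simp: simple_graph_def)
  have "vertex_degree E v = (\<Sum>u\<in>V. if {u, v} \<in> E then 1 else 0)" for v
  proof -
    have "(\<Sum>u\<in>V. if {u, v} \<in> E then 1 else 0::nat) = card (V \<inter> {u. {u, v} \<in> E})"
      using V by (simp add: sum.If_cases)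
    also have "V \<inter> {u. {u, v} \<in> E} = nbrs E v"
      using nbrs_subset[OF assms(1), of v] by (auto simp: nbrs_def)
    finally show ?thesis using vertex_degree_nbrs[OF assms(1)] by simp
  qed
  then have "(\<Sum>v\<in>K. vertex_degree E v) = (\<Sum>v\<in>K. \<Sum>u\<in>V. if {u, v} \<in> E then 1 else 0)"
    by simp
  also have "\<dots> = (\<Sum>u\<in>V. \<Sum>v\<in>K. if {u, v} \<in> E then 1 else 0)" by (rule sum.swap)
  also have "\<dots> = (\<Sum>u\<in>V. card (nbrs E u \<inter> K))"
    using V by (intro sum.cong) (auto simp: sum.If_cases nbrs_def insert_commute Int_commute)
  finally show ?thesis .
qed

lemma handshake:
  assumes "simple_graph V E"
  shows "even (\<Sum>v\<in>V. vertex_degree E v)"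
proof -
  have V: "finite V" using assms by (auto simp: simple_graph_def)
  note E = simple_graph_finite_edges[OF assms]
  have "(\<Sum>v\<in>V. vertex_degree E v) = (\<Sum>v\<in>V. \<Sum>e\<in>E. if v \<in> e then 1 else 0)"
    using E by (simp add: vertex_degree_def sum.If_cases Int_def)
  also have "\<dots> = (\<Sum>e\<in>E. \<Sum>v\<in>V. if v \<in> e then 1 else 0)" by (rule sum.swap)
  also have "\<dots> = (\<Sum>e\<in>E. card e)"
  proof (intro sum.cong refl)
    fix e assume "e \<in> E"
    then have "V \<inter> {v. v \<in> e} = e" using assms by (auto simp: simple_graph_def)
    then show "(\<Sum>v\<in>V. if v \<in> e then 1 else 0) = card e" using V by (simp add: sum.If_cases)
  qed
  also have "\<dots> = (\<Sum>e\<in>E. 2)"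
    using assms by (intro sum.cong) (auto simp: simple_graph_def)
  finally show ?thesis by simp
qed

lemma vertex_degree_insert:
  assumes "finite E" "e \<notin> E"
  shows "vertex_degree (insert e E) v = vertex_degree E v + of_bool (v \<in> e)"
proof -
  have "{x \<in> insert e E. v \<in> x} = (if v \<in> e then insert e {x \<in> E. v \<in> x} else {x \<in> E. v \<in> x})"
    by auto
  then show ?thesis using assms by (simp add: vertex_degree_def)
qed

lemma vertex_degree_remove:
  assumes "finite E" "e \<in> E"
  shows "vertex_degree (E - {e}) v = vertex_degree E v - of_bool (v \<in> e)"
proof -
  have "vertex_degree E v = vertex_degree (E - {e}) v + of_bool (v \<in> e)"
    using vertex_degree_insert[of "E - {e}" e v] assms by (simp add: insert_absorb)
  then show ?thesis by simp
qed

lemma vertex_degree_pos: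
  assumes "finite E" "e \<in> E" "v \<in> e"
  shows "vertex_degree E v > 0"
  using assms by (auto simp: vertex_degree_def card_gt_0_iff)

text \<open>
  A vertex of larger degree has a neighbour that can be handed over: all edge exchanges below
  replace an edge \<open>ui\<close> by \<open>ur\<close> for such a \<open>u\<close>.
\<close>

lemma private_neighbour:
  assumes "simple_graph V E" "vertex_degree E r < vertex_degree E i"
  obtains u where "u \<noteq> r" "u \<noteq> i" "{u, i} \<in> E" "{u, r} \<notin> E"
proof -
  note fin = finite_nbrs[OF assms(1)]
  have lt: "card (nbrs E r) < card (nbrs E i)"
    using assms(2) vertex_degree_nbrs[OF assms(1)] by simp
  have "\<not> nbrs E i - {r} \<subseteq> nbrs E r"
  proof
    assume sub: "nbrs E i - {r} \<subseteq> nbrs E r"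
    show False
    proof (cases "r \<in> nbrs E i")
      case True
      then have "i \<in> nbrs E r" by (simp only: nbrs_sym)
      have "nbrs E i - {r} \<subseteq> nbrs E r - {i}"
        using sub nbrs_subset[OF assms(1), of i] by auto
      then have "card (nbrs E i - {r}) \<le> card (nbrs E r - {i})" using fin by (intro card_mono) auto
      then have "card (nbrs E i) - 1 \<le> card (nbrs E r) - 1"
        using True \<open>i \<in> nbrs E r\<close> by simp
      moreover have "card (nbrs E r) > 0" using \<open>i \<in> nbrs E r\<close> fin by (auto simp: card_gt_0_iff)
      ultimately show False using lt by simp
    next
      case False
      then have "card (nbrs E i) \<le> card (nbrs E r)" using sub fin by (intro card_mono) auto
      then show False using lt by simp
    qed
  qed
  then obtain u where "u \<in> nbrs E i" "u \<noteq> r" "u \<notin> nbrs E r" by auto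
  then show ?thesis using that[of u] nbrs_subset[OF assms(1), of i] by (auto simp: nbrs_def)
qed

text \<open>
  The graphs met while the degrees \<open>d\<close> are realised vertex by vertex, in decreasing order of \<open>d\<close>:
  the vertices before \<open>r\<close> are saturated, vertex \<open>r\<close> is being worked on, and the vertices after \<open>r\<close>
  are independent. The last condition bounds their degrees by \<open>r + 1\<close>, which is what the right-hand
  side of the Erdos-Gallai inequality counts.
\<close>

definition subrealization :: "nat \<Rightarrow> (nat \<Rightarrow> nat) \<Rightarrow> nat \<Rightarrow> nat set set \<Rightarrow> bool" where
  "subrealization n d r E \<longleftrightarrow> simple_graph {..<n} E \<and> (\<forall>i<n. vertex_degree E i \<le> d i) \<and>
     (\<forall>i<r. vertex_degree E i = d i) \<and> (\<forall>e\<in>E. \<exists>v\<in>e. v \<le> r)"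

text \<open>
  Where no exchange is possible, the Erdos-Gallai inequality for the first \<open>r + 1\<close> vertices is an
  equality if its left-hand side is taken from the graph. Hence it fails for \<open>d\<close> if \<open>r\<close> still has
  a deficit.
\<close>

lemma saturated_clique_bound:
  assumes g: "simple_graph {..<n} E" and r: "r < n"
    and indep: "\<forall>e\<in>E. \<exists>v\<in>e. v \<le> r"
    and clique: "\<And>i j. i \<le> r \<Longrightarrow> j \<le> r \<Longrightarrow> i \<noteq> j \<Longrightarrow> {i, j} \<in> E"
    and outer: "\<And>k. r < k \<Longrightarrow> k < n \<Longrightarrow> vertex_degree E k = min (d k) (Suc r)"
    and large: "\<And>i. i \<le> r \<Longrightarrow> Suc r \<le> d i"
  shows "(\<Sum>i<Suc r. vertex_degree E i) + Suc r = (\<Sum>i<n. min (d i) (Suc r))"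
proof -
  have sub: "{..<Suc r} \<subseteq> {..<n}" using r by auto
  have count: "card (nbrs E u \<inter> {..<Suc r}) + of_bool (u \<le> r) = min (d u) (Suc r)" if "u < n" for u
  proof (cases "u \<le> r")
    case True
    then have "nbrs E u \<inter> {..<Suc r} = {..<Suc r} - {u}"
      using clique nbrs_subset[OF g, of u] by (auto simp: nbrs_def)
    then show ?thesis using True large[of u] by simp
  next
    case False
    have "nbrs E u \<subseteq> {..<Suc r}"
    proof
      fix v assume "v \<in> nbrs E u"
      then have "{v, u} \<in> E" by (simp add: nbrs_def)
      then show "v \<in> {..<Suc r}" using indep False by fastforce
    qed
    then have "nbrs E u \<inter> {..<Suc r} = nbrs E u" by auto
    then show ?thesis using False outer[of u] that vertex_degree_nbrs[OF g, of u] by simp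
  qed
  have "(\<Sum>u<n. of_bool (u \<le> r)) = Suc r"
  proof -
    have "{..<n} \<inter> {u. u \<le> r} = {..r}" using r by auto
    then show ?thesis by (simp add: of_bool_def sum.If_cases)
  qed
  then have "(\<Sum>i<Suc r. vertex_degree E i) + Suc r
      = (\<Sum>u<n. card (nbrs E u \<inter> {..<Suc r}) + of_bool (u \<le> r))"
    using sum_degree_double_count[OF g sub] by (simp add: sum.distrib)
  also have "\<dots> = (\<Sum>i<n. min (d i) (Suc r))" using count by simp
  finally show ?thesis .
qed

text \<open>
  The exchange step of Tripathi, Venugopalan and West. Vertex \<open>r\<close> gains an edge without disturbing
  the saturated vertices: directly (case \<open>add\<close>), or through a missing edge from \<open>r\<close> to an earlier
  vertex (\<open>lower\<close>), from an earlier vertex to an unsaturated later one (\<open>upper\<close>), or between two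
  earlier vertices (\<open>clique\<close>). If nothing is missing, \<open>r\<close> is adjacent to all earlier vertices, which
  forces \<open>d r \<ge> r + 1\<close>. So the inequality is needed only at indices inside the Durfee square.
\<close>

lemma improve_subrealization:
  fixes d :: "nat \<Rightarrow> nat"
  assumes sr: "subrealization n d r E" and r: "r < n" and deficit: "vertex_degree E r < d r"
    and anti: "\<And>i j. i \<le> j \<Longrightarrow> j < n \<Longrightarrow> d j \<le> d i"
    and even: "even (\<Sum>i<n. d i)"
    and eg: "Suc r \<le> d r \<Longrightarrow> Suc r + (\<Sum>i<Suc r. d i) \<le> (\<Sum>i<n. min (d i) (Suc r))"
  shows "\<exists>E'. subrealization n d r E' \<and> vertex_degree E r < vertex_degree E' r"
proof -
  have g: "simple_graph {..<n} E" and le: "\<And>i. i < n \<Longrightarrow> vertex_degree E i \<le> d i"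
    and eq: "\<And>i. i < r \<Longrightarrow> vertex_degree E i = d i" and indep: "\<forall>e\<in>E. \<exists>v\<in>e. v \<le> r"
    using sr by (auto simp: subrealization_def)
  note finE = simple_graph_finite_edges[OF g]
  note edge = simple_graph_edge[OF g]
  have private_nbr: "\<exists>u. u \<noteq> r \<and> u \<noteq> i \<and> {u, i} \<in> E \<and> {u, r} \<notin> E \<and> u < n" if "i < r" for i
  proof -
    have "vertex_degree E r < vertex_degree E i"
      using deficit anti[of i r] eq[of i] that r by auto
    then obtain u where "u \<noteq> r" "u \<noteq> i" "{u, i} \<in> E" "{u, r} \<notin> E"
      using private_neighbour[OF g] by metis
    then show ?thesis using edge by blast
  qed
  consider
      (add) i where "r < i" "i < n" "vertex_degree E i < d i" "{r, i} \<notin> E"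
    | (lower) i where "i < r" "{r, i} \<notin> E"
        "\<And>k. r < k \<Longrightarrow> k < n \<Longrightarrow> vertex_degree E k < d k \<Longrightarrow> {r, k} \<in> E"
    | (upper) i k where "i < r" "r < k" "k < n" "vertex_degree E k < d k" "{i, k} \<notin> E"
    | (clique) i j where "i < r" "j < r" "i \<noteq> j" "{i, j} \<notin> E" "\<And>i. i < r \<Longrightarrow> {r, i} \<in> E"
    | (tight) "\<And>i. i < r \<Longrightarrow> {r, i} \<in> E"
        "\<And>i j. i < r \<Longrightarrow> j < r \<Longrightarrow> i \<noteq> j \<Longrightarrow> {i, j} \<in> E"
        "\<And>k. r < k \<Longrightarrow> k < n \<Longrightarrow> vertex_degree E k < d k \<Longrightarrow> {r, k} \<in> E"
        "\<And>i k. i < r \<Longrightarrow> r < k \<Longrightarrow> k < n \<Longrightarrow> vertex_degree E k < d k \<Longrightarrow> {i, k} \<in> E"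
  proof (cases "\<exists>i. r < i \<and> i < n \<and> vertex_degree E i < d i \<and> {r, i} \<notin> E")
    case True
    with that(1) show ?thesis by blast
  next
    case False
    then have nadd: "\<And>k. r < k \<Longrightarrow> k < n \<Longrightarrow> vertex_degree E k < d k \<Longrightarrow> {r, k} \<in> E"
      by blast
    show ?thesis
    proof (cases "\<forall>i<r. {r, i} \<in> E")
      case False
      with that(2) nadd show ?thesis by blast
    next
      case adj: True
      show ?thesis
      proof (cases "\<forall>i<r. \<forall>j<r. i \<noteq> j \<longrightarrow> {i, j} \<in> E")
        case False
        then obtain i j where "i < r" "j < r" "i \<noteq> j" "{i, j} \<notin> E" by blast
        then show ?thesis using that(4) adj by simp
      next
        case cl: True
        show ?thesis
        proof (cases "\<exists>i k. i < r \<and> r < k \<and> k < n \<and> vertex_degree E k < d k \<and> {i, k} \<notin> E")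
          case True
          then obtain i k where "i < r" "r < k" "k < n" "vertex_degree E k < d k" "{i, k} \<notin> E"
            by blast
          then show ?thesis using that(3) by simp
        next
          case False
          show ?thesis
            by (rule that(5)) (use adj cl nadd False in \<open>simp_all\<close>)
        qed
      qed
    qed
  qed
  then show ?thesis
  proof cases
    case add
    let ?E = "insert {r, i} E"
    have "subrealization n d r ?E"
      using g le eq indep add r deficit
      by (auto simp: subrealization_def vertex_degree_insert[OF finE] simple_graph_def of_bool_def
          Suc_le_eq)
    moreover have "vertex_degree ?E r = Suc (vertex_degree E r)"
      using add by (simp add: vertex_degree_insert[OF finE])
    ultimately show ?thesis by (metis lessI)
  next
    case lower
    obtain u where u: "u \<noteq> r" "u \<noteq> i" "{u, i} \<in> E" "{u, r} \<notin> E" "u < n" using private_nbr lower by blast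
    show ?thesis
    proof (cases "Suc (Suc (vertex_degree E r)) \<le> d r")
      case True
      let ?E = "insert {r, i} (insert {u, r} (E - {{u, i}}))"
      have new: "{u, r} \<notin> E - {{u, i}}" "{r, i} \<notin> insert {u, r} (E - {{u, i}})"
        using u lower by (auto simp: doubleton_eq_iff insert_commute)
      have dv: "vertex_degree ?E v = vertex_degree E v - of_bool (v \<in> {u, i})
          + of_bool (v \<in> {u, r}) + of_bool (v \<in> {r, i})" for v
        by (simp add: vertex_degree_insert[OF _ new(1)] vertex_degree_insert[OF _ new(2)]
            vertex_degree_remove[OF finE u(3)] finE)
      have pos: "vertex_degree E u > 0" "vertex_degree E i > 0"
        using vertex_degree_pos[OF finE u(3)] by auto
      have "subrealization n d r ?E"
        unfolding subrealization_def
      proof (intro conjI allI impI)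
        show "simple_graph {..<n} ?E" using g lower(1) r u by (auto simp: simple_graph_def)
        show "\<forall>e\<in>?E. \<exists>v\<in>e. v \<le> r" using indep by auto
        have change: "vertex_degree ?E v = vertex_degree E v + 2 * of_bool (v = r)" for v
          unfolding dv using pos u(1,2) lower(1) by (cases "v = u"; cases "v = i"; cases "v = r") auto
        show "vertex_degree ?E v \<le> d v" if "v < n" for v
          unfolding change using le[OF that] True by (cases "v = r") auto
        show "vertex_degree ?E v = d v" if "v < r" for v
          unfolding change using eq[OF that] that by simp
      qed
      moreover have "vertex_degree E r < vertex_degree ?E r" using dv u lower by simp
      ultimately show ?thesis by blast
    next
      case False
      \<comment> \<open>Gaining two edges would overshoot. By parity some later \<open>k\<close> has a deficit too, and \<open>rk\<close> is
        an edge, so \<open>r\<close> can give up that edge and still gain one.\<close>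
      then have one: "d r = Suc (vertex_degree E r)" using deficit by simp
      have "\<exists>k>r. k < n \<and> vertex_degree E k < d k"
      proof (rule ccontr)
        assume "\<not> ?thesis"
        then have "vertex_degree E k = d k" if "r < k" "k < n" for k
          using that le[of k] by (metis le_neq_implies_less)
        then have "(\<Sum>i<n. d i) = (\<Sum>i<n. vertex_degree E i + of_bool (i = r))"
          using eq one by (intro sum.cong) (auto simp: neq_iff)
        also have "\<dots> = (\<Sum>i<n. vertex_degree E i) + 1"
          using r by (simp add: sum.distrib of_bool_def)
        finally show False using handshake[OF g] even by simp
      qed
      then obtain k where k: "r < k" "k < n" "vertex_degree E k < d k" by blast
      then have rk: "{r, k} \<in> E" using lower by blast
      have uk: "u \<noteq> k" using rk u by (auto simp: insert_commute)
      let ?E = "insert {r, i} (insert {u, r} (E - {{u, i}} - {{r, k}}))"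
      have new: "{u, r} \<notin> E - {{u, i}} - {{r, k}}" "{r, i} \<notin> insert {u, r} (E - {{u, i}} - {{r, k}})"
        using u lower k uk rk by (auto simp: doubleton_eq_iff insert_commute)
      have old: "{r, k} \<in> E - {{u, i}}"
        using u lower k uk rk by (auto simp: doubleton_eq_iff)
      have dv: "vertex_degree ?E v = vertex_degree E v - of_bool (v \<in> {u, i}) - of_bool (v \<in> {r, k})
          + of_bool (v \<in> {u, r}) + of_bool (v \<in> {r, i})" for v
        by (simp add: vertex_degree_insert[OF _ new(1)] vertex_degree_insert[OF _ new(2)]
            vertex_degree_remove[OF finE u(3)] vertex_degree_remove[OF _ old] finE)
      have pos: "vertex_degree E u > 0" "vertex_degree E i > 0" "vertex_degree E r > 0"
        using vertex_degree_pos[OF finE u(3)] vertex_degree_pos[OF finE rk] by auto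
      have "subrealization n d r ?E"
        unfolding subrealization_def
      proof (intro conjI allI impI)
        show "simple_graph {..<n} ?E" using g lower(1) r u by (auto simp: simple_graph_def)
        show "\<forall>e\<in>?E. \<exists>v\<in>e. v \<le> r" using indep by auto
        have change: "vertex_degree ?E v = vertex_degree E v + of_bool (v = r) - of_bool (v = k)" for v
          unfolding dv using pos u(1,2) lower(1) k(1) uk by (cases "v = u"; cases "v = i"; cases "v = r") auto
        show "vertex_degree ?E v \<le> d v" if "v < n" for v
          unfolding change using le[OF that] deficit by (cases "v = r") auto
        show "vertex_degree ?E v = d v" if "v < r" for v
          unfolding change using eq[OF that] that k by simp
      qed
      moreover have "vertex_degree E r < vertex_degree ?E r" using dv u lower k pos by simp
      ultimately show ?thesis by blast
    qed
  next
    case upper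
    obtain u where u: "u \<noteq> r" "u \<noteq> i" "{u, i} \<in> E" "{u, r} \<notin> E" "u < n" using private_nbr upper by blast
    have uk: "u \<noteq> k" using upper u by (auto simp: insert_commute)
    let ?E = "insert {i, k} (insert {u, r} (E - {{u, i}}))"
    have new: "{u, r} \<notin> E - {{u, i}}" "{i, k} \<notin> insert {u, r} (E - {{u, i}})"
      using u upper uk by (auto simp: doubleton_eq_iff insert_commute)
    have dv: "vertex_degree ?E v = vertex_degree E v - of_bool (v \<in> {u, i})
        + of_bool (v \<in> {u, r}) + of_bool (v \<in> {i, k})" for v
      by (simp add: vertex_degree_insert[OF _ new(1)] vertex_degree_insert[OF _ new(2)]
            vertex_degree_remove[OF finE u(3)] finE)
    have pos: "vertex_degree E u > 0" "vertex_degree E i > 0"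
      using vertex_degree_pos[OF finE u(3)] by auto
    have "subrealization n d r ?E"
      unfolding subrealization_def
    proof (intro conjI allI impI)
      show "simple_graph {..<n} ?E" using g upper r u by (auto simp: simple_graph_def)
      show "\<forall>e\<in>?E. \<exists>v\<in>e. v \<le> r" using indep upper(1) by auto
      have change: "vertex_degree ?E v = vertex_degree E v + of_bool (v = r) + of_bool (v = k)" for v
        unfolding dv using pos u(1,2) upper(1,2) uk by (cases "v = u"; cases "v = i"; cases "v = r") auto
      show "vertex_degree ?E v \<le> d v" if "v < n" for v
        unfolding change using le[OF that] deficit upper(2,4) by (cases "v = r"; cases "v = k") auto
      show "vertex_degree ?E v = d v" if "v < r" for v
        unfolding change using eq[OF that] that upper(2) by simp
    qed
    moreover have "vertex_degree E r < vertex_degree ?E r" using dv u upper by simp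
    ultimately show ?thesis by blast
  next
    case clique
    obtain u where u: "u \<noteq> r" "u \<noteq> i" "{u, i} \<in> E" "{u, r} \<notin> E" "u < n" using private_nbr clique by blast
    obtain w where w: "w \<noteq> r" "w \<noteq> j" "{w, j} \<in> E" "{w, r} \<notin> E" "w < n" using private_nbr clique by blast
    \<comment> \<open>\<open>r\<close> is adjacent to every earlier vertex, so \<open>u\<close> and \<open>w\<close> come later, where it does no harm
      that \<open>w\<close> loses a degree.\<close>
    have uw: "r < u" "r < w"
      using u w clique(5) by (metis insert_commute linorder_neqE_nat)+
    let ?E = "insert {i, j} (insert {u, r} (E - {{u, i}} - {{w, j}}))"
    have new: "{u, r} \<notin> E - {{u, i}} - {{w, j}}" "{i, j} \<notin> insert {u, r} (E - {{u, i}} - {{w, j}})"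
      using u w clique uw by (auto simp: doubleton_eq_iff insert_commute)
    have old: "{w, j} \<in> E - {{u, i}}"
      using u w clique uw by (auto simp: doubleton_eq_iff)
    have dv: "vertex_degree ?E v = vertex_degree E v - of_bool (v \<in> {u, i}) - of_bool (v \<in> {w, j})
        + of_bool (v \<in> {u, r}) + of_bool (v \<in> {i, j})" for v
      by (simp add: vertex_degree_insert[OF _ new(1)] vertex_degree_insert[OF _ new(2)]
            vertex_degree_remove[OF finE u(3)] vertex_degree_remove[OF _ old] finE)
    have pos: "vertex_degree E u > 0" "vertex_degree E i > 0" "vertex_degree E j > 0"
      using vertex_degree_pos[OF finE u(3)] vertex_degree_pos[OF finE w(3)] by auto
    have "subrealization n d r ?E"
      unfolding subrealization_def
    proof (intro conjI allI impI)
      show "simple_graph {..<n} ?E" using g clique r u by (auto simp: simple_graph_def)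
      show "\<forall>e\<in>?E. \<exists>v\<in>e. v \<le> r" using indep clique by auto
      show "vertex_degree ?E v \<le> d v" if "v < n" for v
      proof -
        have "vertex_degree ?E v \<le> vertex_degree E v + of_bool (v = r)"
          unfolding dv using pos u(1,2) w(1,2) clique(1-3) uw by (cases "v = u"; cases "v = i"; cases "v = j") auto
        then show ?thesis using le[OF that] deficit by (cases "v = r") auto
      qed
      show "vertex_degree ?E v = d v" if "v < r" for v
      proof -
        have "v \<noteq> u" "v \<noteq> w" "v \<noteq> r" using that uw by auto
        then have "vertex_degree ?E v = vertex_degree E v"
          unfolding dv using pos u(1,2) w(1,2) clique(1-3) by (cases "v = i"; cases "v = j") auto
        then show ?thesis using eq[OF that] by simp
      qed
    qed
    moreover have "vertex_degree E r < vertex_degree ?E r" using dv u clique uw by simp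
    ultimately show ?thesis by blast
  next
    case tight
    have cl: "{i, j} \<in> E" if "i \<le> r" "j \<le> r" "i \<noteq> j" for i j
      using tight(1,2) that by (metis insert_commute le_neq_implies_less)
    have "{..<r} \<subseteq> nbrs E r" using cl by (auto simp: nbrs_def)
    then have "r \<le> vertex_degree E r"
      using card_mono[OF finite_nbrs[OF g, of r], of "{..<r}"] vertex_degree_nbrs[OF g] by simp
    then have dr: "Suc r \<le> d r" using deficit by simp
    have outer: "vertex_degree E k = min (d k) (Suc r)" if k: "r < k" "k < n" for k
    proof -
      have "nbrs E k \<subseteq> {..r}" using indep k by (fastforce simp: nbrs_def)
      then have "card (nbrs E k) \<le> card {..r}" by (intro card_mono) auto
      then have up: "vertex_degree E k \<le> Suc r" using vertex_degree_nbrs[OF g] by simp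
      show ?thesis
      proof (cases "vertex_degree E k < d k")
        case True
        then have "{..r} \<subseteq> nbrs E k"
          using tight(4)[OF _ k] tight(3)[OF k] by (auto simp: nbrs_def le_less)
        then have "card {..r} \<le> card (nbrs E k)" using finite_nbrs[OF g] by (intro card_mono) auto
        then show ?thesis using up True vertex_degree_nbrs[OF g, of k] by simp
      next
        case False
        then show ?thesis using up le[OF k(2)] by simp
      qed
    qed
    have "(\<Sum>i<Suc r. vertex_degree E i) + Suc r = (\<Sum>i<n. min (d i) (Suc r))"
      using anti r dr by (intro saturated_clique_bound[OF g r indep cl outer]) (auto intro: le_trans)
    moreover have "(\<Sum>i<r. vertex_degree E i) = (\<Sum>i<r. d i)" using eq by simp
    ultimately have "False" using eg[OF dr] deficit by simp
    then show ?thesis ..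
  qed
qed

lemma realization_exists:
  fixes d :: "nat \<Rightarrow> nat"
  assumes anti: "\<And>i j. i \<le> j \<Longrightarrow> j < n \<Longrightarrow> d j \<le> d i"
    and even: "even (\<Sum>i<n. d i)"
    and eg: "\<And>r. r < n \<Longrightarrow> Suc r \<le> d r \<Longrightarrow>
      Suc r + (\<Sum>i<Suc r. d i) \<le> (\<Sum>i<n. min (d i) (Suc r))"
  shows "\<exists>E. simple_graph {..<n} E \<and> (\<forall>i<n. vertex_degree E i = d i)"
proof -
  have "\<exists>E. subrealization n d r E" if "r \<le> n" for r
    using that
  proof (induction r)
    case 0
    have "subrealization n d 0 {}"
      by (simp add: subrealization_def simple_graph_def vertex_degree_def)
    then show ?case by blast
  next
    case (Suc r)
    then have r: "r < n" and "\<exists>E. subrealization n d r E" by simp_all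
    then have ex: "\<exists>m E. subrealization n d r E \<and> vertex_degree E r = m" by simp
    have bound: "\<forall>m. (\<exists>E. subrealization n d r E \<and> vertex_degree E r = m) \<longrightarrow> m \<le> d r"
      using r by (auto simp: subrealization_def)
    obtain E where E: "subrealization n d r E"
      and greatest: "\<And>E'. subrealization n d r E' \<Longrightarrow> vertex_degree E' r \<le> vertex_degree E r"
      using ex_has_greatest_nat[of "subrealization n d r" _ "\<lambda>E. vertex_degree E r" "Suc (d r)"]
        ex bound by (metis less_Suc_eq_le)
    have "vertex_degree E r = d r"
    proof (rule ccontr)
      assume "vertex_degree E r \<noteq> d r"
      then have "vertex_degree E r < d r" using E bound by (metis le_neq_implies_less)
      then show False
        using improve_subrealization[OF E r _ anti even eg[OF r]] greatest by (meson leD)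
    qed
    moreover have "\<exists>v\<in>e. v \<le> Suc r" if "e \<in> E" for e
      using that E unfolding subrealization_def by (meson le_SucI)
    ultimately have "subrealization n d (Suc r) E"
      using E by (auto simp: subrealization_def less_Suc_eq)
    then show ?case by blast
  qed
  then obtain E where "subrealization n d n E" by blast
  then show ?thesis by (auto simp: subrealization_def)
qed

text \<open>
  Double counting of the edges that meet \<open>K\<close>. A vertex of \<open>K\<close> has at most \<open>card K - 1\<close> neighbours
  in \<open>K\<close>, and its large degree leaves room for the extra unit on the left.
\<close>

lemma degree_sum_bound:
  assumes g: "simple_graph V E" and K: "K \<subseteq> V" and large: "\<And>v. v \<in> K \<Longrightarrow> card K \<le> vertex_degree E v"
  shows "card K + (\<Sum>v\<in>K. vertex_degree E v) \<le> (\<Sum>u\<in>V. min (vertex_degree E u) (card K))"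
proof -
  have V: "finite V" "finite K"
    using g K finite_subset by (auto simp: simple_graph_def)
  have "card K = (\<Sum>u\<in>V. of_bool (u \<in> K))"
    using V K by (simp add: of_bool_def sum.If_cases Int_absorb1)
  then have "card K + (\<Sum>v\<in>K. vertex_degree E v) = (\<Sum>u\<in>V. of_bool (u \<in> K) + card (nbrs E u \<inter> K))"
    using sum_degree_double_count[OF g K] by (simp add: sum.distrib)
  also have "\<dots> \<le> (\<Sum>u\<in>V. min (vertex_degree E u) (card K))"
  proof (rule sum_mono)
    fix u assume "u \<in> V"
    show "of_bool (u \<in> K) + card (nbrs E u \<inter> K) \<le> min (vertex_degree E u) (card K)"
    proof (cases "u \<in> K")
      case True
      have "nbrs E u \<inter> K \<subseteq> K - {u}" using nbrs_subset[OF g, of u] by auto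
      then have "card (nbrs E u \<inter> K) \<le> card (K - {u})" using V by (intro card_mono) auto
      moreover have "Suc (card (K - {u})) = card K" using True V by (simp only: card_Suc_Diff1)
      ultimately show ?thesis using True large[OF True] by simp
    next
      case False
      have "card (nbrs E u \<inter> K) \<le> card (nbrs E u)" "card (nbrs E u \<inter> K) \<le> card K"
        using V finite_nbrs[OF g] by (auto intro: card_mono)
      then show ?thesis using False vertex_degree_nbrs[OF g] by simp
    qed
  qed
  finally show ?thesis .
qed

text \<open>
  The Erdos-Gallai criterion restricted to the indices \<open>j\<close> inside the Durfee square, where
  \<open>min p j = j\<close> for the first \<open>j\<close> parts. In this form it is Nash-Williams' condition on ranks.
\<close>

theorem graphic_iff:
  assumes sorted: "sorted_wrt (\<ge>) ds"
  shows "(\<exists>(V :: nat set) E. simple_graph V E \<and> card V = length ds \<and> mset ds = degree_multiset V E) \<longleftrightarrow>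
    even (sum_list ds) \<and>
    (\<forall>j\<ge>1. j \<le> length ds \<longrightarrow> j \<le> ds ! (j - 1) \<longrightarrow>
       j + sum_list (take j ds) \<le> (\<Sum>p\<leftarrow>ds. min p j))" (is "?lhs \<longleftrightarrow> ?rhs")
proof
  assume ?lhs
  then obtain V :: "nat set" and E where g: "simple_graph V E" and m: "mset ds = degree_multiset V E"
    by blast
  have fin: "finite V" using g by (simp add: simple_graph_def)
  let ?f = "vertex_degree E"
  define vs where "vs = rev (sort_key ?f (sorted_list_of_set V))"
  have vs: "distinct vs" "set vs = V" using fin by (auto simp: vs_def)
  have "sorted_wrt (\<ge>) (map ?f vs)"
    by (simp add: vs_def sorted_wrt_rev flip: rev_map)
  moreover have "mset (map ?f vs) = mset ds"
    using vs m by (metis degree_multiset_def mset_map mset_set_set)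
  ultimately have ds: "ds = map ?f vs"
    using sorted by (metis mset_rev properties_for_sort rev_rev_ident sorted_wrt_rev)
  have sum_f: "(\<Sum>v\<leftarrow>vs. h (?f v)) = (\<Sum>v\<in>V. h (?f v))" for h :: "nat \<Rightarrow> nat"
    using sum_list_distinct_conv_sum_set[OF vs(1)] vs(2) by simp
  show ?rhs
  proof (intro conjI allI impI)
    show "even (sum_list ds)" using handshake[OF g] sum_f[of "\<lambda>x. x"] ds by simp
    fix j assume j: "1 \<le> j" "j \<le> length ds" "j \<le> ds ! (j - 1)"
    let ?K = "set (take j vs)"
    have dist: "distinct (take j vs)" using vs by simp
    have card: "card ?K = j" using distinct_card[OF dist] j ds by simp
    have "j \<le> ?f v" if "v \<in> ?K" for v
    proof -
      obtain i where i: "i < j" "i < length vs" "v = vs ! i" using \<open>v \<in> ?K\<close> by (auto simp: in_set_conv_nth)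
      then have "ds ! (j - 1) \<le> ds ! i"
        using sorted j ds by (cases "i = j - 1") (auto simp: sorted_wrt_iff_nth_less)
      then show ?thesis using j i ds by simp
    qed
    moreover have "?K \<subseteq> V" using vs set_take_subset by metis
    ultimately have "j + (\<Sum>v\<in>?K. ?f v) \<le> (\<Sum>u\<in>V. min (?f u) j)"
      using degree_sum_bound[OF g, of ?K] card by simp
    moreover have "(\<Sum>v\<in>?K. ?f v) = sum_list (take j ds)"
      unfolding ds take_map by (rule sum_list_distinct_conv_sum_set[OF dist, symmetric])
    moreover have "(\<Sum>u\<in>V. min (?f u) j) = (\<Sum>p\<leftarrow>ds. min p j)"
      using sum_f[of "\<lambda>x. min x j"] ds by (simp add: comp_def)
    ultimately show "j + sum_list (take j ds) \<le> (\<Sum>p\<leftarrow>ds. min p j)" by simp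
  qed
next
  assume R: ?rhs
  let ?n = "length ds"
  have sum_nth: "(\<Sum>p\<leftarrow>ds. h p) = (\<Sum>i<?n. h (ds ! i))" for h :: "nat \<Rightarrow> nat"
    by (simp add: sum_list_sum_nth atLeast0LessThan)
  have "\<exists>E. simple_graph {..<?n} E \<and> (\<forall>i<?n. vertex_degree E i = ds ! i)"
  proof (rule realization_exists)
    show "ds ! j \<le> ds ! i" if "i \<le> j" "j < ?n" for i j
      using sorted that by (cases "i = j") (auto simp: sorted_wrt_iff_nth_less)
    show "even (\<Sum>i<?n. ds ! i)" using R sum_nth[of "\<lambda>x. x"] by simp
    show "Suc r + (\<Sum>i<Suc r. ds ! i) \<le> (\<Sum>i<?n. min (ds ! i) (Suc r))"
      if "r < ?n" "Suc r \<le> ds ! r" for r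
    proof -
      have "sum_list (take (Suc r) ds) = (\<Sum>i<Suc r. ds ! i)"
        using that by (simp add: sum_list_sum_nth atLeast0LessThan del: take_Suc)
      moreover have "Suc r + sum_list (take (Suc r) ds) \<le> (\<Sum>p\<leftarrow>ds. min p (Suc r))"
        using R[THEN conjunct2, rule_format, of "Suc r"] that by simp
      ultimately show ?thesis using sum_nth[of "\<lambda>x. min x (Suc r)"] by simp
    qed
  qed
  then obtain E where E: "simple_graph {..<?n} E" "\<And>i. i < ?n \<Longrightarrow> vertex_degree E i = ds ! i" by blast
  have "degree_multiset {..<?n} E = image_mset ((!) ds) (mset_set {..<?n})"
    unfolding degree_multiset_def using E(2) by (intro image_mset_cong) simp
  also have "\<dots> = mset ds"
    by (metis atLeast0LessThan map_nth mset_map mset_upt)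
  finally show ?lhs using E(1) by (metis card_lessThan)
qed

section \<open>Ranks and removal of the outer hook\<close>

text \<open>
  The condition that selects \<open>Ps N k l s\<close> inside \<open>P N k l\<close>; the integer \<open>s\<close> is the slack with which
  the partial sums of ranks start.
\<close>

definition rank_cond :: "int \<Rightarrow> nat list \<Rightarrow> bool" where
  "rank_cond s \<pi> \<longleftrightarrow> 0 \<le> s \<and> (\<forall>j\<in>{1..durfee \<pi>}. int j \<le> s + (\<Sum>i=1..j. rank_at \<pi> i))"

lemma durfee_ge_iff:
  assumes "is_partition \<pi>" "1 \<le> j"
  shows "j \<le> durfee \<pi> \<longleftrightarrow> j \<le> length \<pi> \<and> j \<le> \<pi> ! (j - 1)"
proof -
  let ?S = "{m. {1..m} \<times> {1..m} \<subseteq> ferrers \<pi>}"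
  have le: "m \<le> length \<pi>" if "m \<in> ?S" for m
  proof (cases "m = 0")
    case False
    then have "(m, m) \<in> ferrers \<pi>" using that by auto
    then show ?thesis by (simp add: ferrers_def)
  qed simp
  then have fin: "finite ?S" by (meson finite_nat_set_iff_bounded_le)
  have "0 \<in> ?S" by simp
  then have "Max ?S \<in> ?S" using Max_in[OF fin] by blast
  have "j \<le> Max ?S \<longleftrightarrow> j \<in> ?S"
  proof
    assume "j \<le> Max ?S"
    then have "{1..j} \<times> {1..j} \<subseteq> {1..Max ?S} \<times> {1..Max ?S}" by auto
    then show "j \<in> ?S" using \<open>Max ?S \<in> ?S\<close> by blast
  qed (use fin in auto)
  also have "\<dots> \<longleftrightarrow> j \<le> length \<pi> \<and> j \<le> \<pi> ! (j - 1)"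
  proof
    assume "j \<in> ?S"
    then have "(j, j) \<in> ferrers \<pi>" using assms by auto
    then show "j \<le> length \<pi> \<and> j \<le> \<pi> ! (j - 1)" by (simp add: ferrers_def)
  next
    assume j: "j \<le> length \<pi> \<and> j \<le> \<pi> ! (j - 1)"
    have "\<pi> ! (j - 1) \<le> \<pi> ! (i - 1)" if "1 \<le> i" "i \<le> j" for i
    proof (cases "i = j")
      case False
      then have "i - 1 < j - 1" "j - 1 < length \<pi>" using that j by auto
      then show ?thesis using assms(1) by (auto simp: is_partition_def sorted_wrt_iff_nth_less)
    qed simp
    then show "j \<in> ?S" using j by (fastforce simp: ferrers_def)
  qed
  finally show ?thesis by (simp add: durfee_def)
qed

text \<open>
  A row of length \<open>p\<close> meets the first \<open>j\<close> columns in \<open>min p j\<close> dots. So a sum of ranks is exactly the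
  difference of the two sides of an Erdos-Gallai inequality.
\<close>

lemma sum_rank_at:
  assumes "j \<le> length \<pi>"
  shows "(\<Sum>i=1..j. rank_at \<pi> i) = int (\<Sum>p\<leftarrow>\<pi>. min p j) - int (sum_list (take j \<pi>))"
proof -
  let ?n = "length \<pi>"
  have row: "row_size \<pi> i = \<pi> ! (i - 1)" if "i \<in> {1..j}" for i
  proof -
    have "{q. (i, q) \<in> ferrers \<pi>} = {1..\<pi> ! (i - 1)}" using that assms by (auto simp: ferrers_def)
    then show ?thesis by (simp add: row_size_def)
  qed
  have "(\<Sum>i=1..j. row_size \<pi> i) = (\<Sum>i=1..j. \<pi> ! (i - 1))" using row by simp
  also have "\<dots> = (\<Sum>i<j. \<pi> ! i)"
    by (rule sum.reindex_bij_witness[of _ Suc "\<lambda>i. i - 1"]) auto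
  also have "\<dots> = sum_list (take j \<pi>)" using assms by (simp add: sum_list_sum_nth atLeast0LessThan)
  finally have rows: "(\<Sum>i=1..j. row_size \<pi> i) = sum_list (take j \<pi>)" .
  have col: "col_size \<pi> i = (\<Sum>r<?n. if i \<le> \<pi> ! r then 1 else 0)" if "i \<in> {1..j}" for i
  proof -
    have "{r. (r, i) \<in> ferrers \<pi>} = Suc ` ({..<?n} \<inter> {r. i \<le> \<pi> ! r})"
    proof (intro set_eqI iffI)
      fix r assume "r \<in> {r. (r, i) \<in> ferrers \<pi>}"
      then show "r \<in> Suc ` ({..<?n} \<inter> {r. i \<le> \<pi> ! r})"
        by (intro image_eqI[of _ _ "r - 1"]) (auto simp: ferrers_def)
    qed (use that in \<open>auto simp: ferrers_def\<close>)
    then show ?thesis by (simp add: col_size_def card_image sum.If_cases)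
  qed
  have "(\<Sum>i=1..j. col_size \<pi> i) = (\<Sum>i=1..j. \<Sum>r<?n. if i \<le> \<pi> ! r then 1 else 0)" using col by simp
  also have "\<dots> = (\<Sum>r<?n. \<Sum>i=1..j. if i \<le> \<pi> ! r then 1 else 0)" by (rule sum.swap)
  also have "\<dots> = (\<Sum>r<?n. min (\<pi> ! r) j)"
  proof (intro sum.cong refl)
    fix r
    have "{1..j} \<inter> {i. i \<le> \<pi> ! r} = {1..min (\<pi> ! r) j}" by auto
    then show "(\<Sum>i=1..j. if i \<le> \<pi> ! r then 1 else 0) = min (\<pi> ! r) j" by (simp add: sum.If_cases)
  qed
  also have "\<dots> = (\<Sum>p\<leftarrow>\<pi>. min p j)" by (simp add: sum_list_sum_nth atLeast0LessThan)
  finally have "(\<Sum>i=1..j. col_size \<pi> i) = (\<Sum>p\<leftarrow>\<pi>. min p j)" .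
  moreover have "(\<Sum>i=1..j. rank_at \<pi> i) = int (\<Sum>i=1..j. col_size \<pi> i) - int (\<Sum>i=1..j. row_size \<pi> i)"
    by (simp add: rank_at_def sum_subtractf)
  ultimately show ?thesis by (simp only: rows)
qed

lemma rank_cond_iff:
  assumes "is_partition \<pi>"
  shows "rank_cond s \<pi> \<longleftrightarrow> 0 \<le> s \<and> (\<forall>j\<ge>1. j \<le> length \<pi> \<longrightarrow> j \<le> \<pi> ! (j - 1) \<longrightarrow>
    int j + int (sum_list (take j \<pi>)) \<le> s + int (\<Sum>p\<leftarrow>\<pi>. min p j))"
  using durfee_ge_iff[OF assms] sum_rank_at[of _ \<pi>] unfolding rank_cond_def
  by (smt (verit) atLeastAtMost_iff)

lemma rank_cond_Nil [simp]: "rank_cond s [] \<longleftrightarrow> 0 \<le> s"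
  using rank_cond_iff[of "[]"] by (simp add: is_partition_def)

definition box :: "nat \<Rightarrow> nat \<Rightarrow> nat list set" where
  "box k l = {\<pi>. is_partition \<pi> \<and> length \<pi> \<le> l \<and> (\<forall>p\<in>set \<pi>. p \<le> k)}"

lemma finite_box: "finite (box k l)"
proof -
  have "box k l \<subseteq> {xs. set xs \<subseteq> {..k} \<and> length xs \<le> l}" by (auto simp: box_def)
  then show ?thesis using finite_lists_length_le[of "{..k}" l] finite_subset by blast
qed

text \<open>
  Glues a first row of length \<open>k + 1\<close> and a first column of length \<open>l + 1\<close> to the diagram of \<open>\<rho>\<close>;
  the rows that \<open>\<rho>\<close> does not reach become ones.
\<close>

definition add_hook :: "nat \<Rightarrow> nat \<Rightarrow> nat list \<Rightarrow> nat list" where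
  "add_hook k l \<rho> = Suc k # map Suc \<rho> @ replicate (l - length \<rho>) 1"

definition full_box :: "nat \<Rightarrow> nat \<Rightarrow> nat list set" where
  "full_box k l = {\<pi>. is_partition \<pi> \<and> length \<pi> = l \<and> \<pi> \<noteq> [] \<and> hd \<pi> = k}"

lemma drop_ones_add_hook:
  assumes "is_partition \<rho>"
  shows "filter (\<lambda>x. 0 < x) (map (\<lambda>x. x - 1) (tl (add_hook k l \<rho>))) = \<rho>"
proof -
  have "filter (\<lambda>x. 0 < x) \<rho> = \<rho>"
    using assms by (auto simp: is_partition_def filter_id_conv)
  then show ?thesis by (simp add: add_hook_def comp_def)
qed

text \<open>
  In a partition the ones form a tail, so they can be erased and put back by their number.
\<close>

lemma sorted_tail_ones:
  assumes "sorted_wrt (\<ge>) xs" "\<forall>x\<in>set xs. 1 \<le> (x::nat)"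
  shows "map Suc (filter (\<lambda>x. 0 < x) (map (\<lambda>x. x - 1) xs)) @
     replicate (length xs - length (filter (\<lambda>x. 0 < x) (map (\<lambda>x. x - 1) xs))) 1 = xs"
  using assms
proof (induction xs)
  case (Cons x xs)
  show ?case
  proof (cases "x = 1")
    case True
    then have "\<forall>y\<in>set xs. y = 1" using Cons.prems by force
    then have "xs = replicate (length xs) 1" by (simp add: replicate_length_same)
    moreover have "filter (\<lambda>x. 0 < x) (map (\<lambda>x. x - 1) xs) = []"
      using \<open>\<forall>y\<in>set xs. y = 1\<close> by (auto simp: filter_empty_conv)
    ultimately show ?thesis using True by simp
  next
    case False
    then have "1 < x" using Cons.prems by auto
    moreover have "map Suc (filter (\<lambda>x. 0 < x) (map (\<lambda>x. x - 1) xs)) @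
      replicate (length xs - length (filter (\<lambda>x. 0 < x) (map (\<lambda>x. x - 1) xs))) 1 = xs"
      using Cons by simp
    ultimately show ?thesis by simp
  qed
qed simp

lemma bij_betw_add_hook: "bij_betw (add_hook k l) (box k l) (full_box (Suc k) (Suc l))"
proof (rule bij_betw_byWitness[where f' = "\<lambda>\<pi>. filter (\<lambda>x. 0 < x) (map (\<lambda>x. x - 1) (tl \<pi>))"])
  show "\<forall>\<rho>\<in>box k l. filter (\<lambda>x. 0 < x) (map (\<lambda>x. x - 1) (tl (add_hook k l \<rho>))) = \<rho>"
    using drop_ones_add_hook by (auto simp: box_def)
  show "\<forall>\<pi>\<in>full_box (Suc k) (Suc l).
      add_hook k l (filter (\<lambda>x. 0 < x) (map (\<lambda>x. x - 1) (tl \<pi>))) = \<pi>"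
  proof
    fix \<pi> assume "\<pi> \<in> full_box (Suc k) (Suc l)"
    then obtain xs where xs: "\<pi> = Suc k # xs" "length xs = l" "sorted_wrt (\<ge>) xs" "\<forall>x\<in>set xs. 1 \<le> x"
      by (cases \<pi>) (auto simp: full_box_def is_partition_def)
    then show "add_hook k l (filter (\<lambda>x. 0 < x) (map (\<lambda>x. x - 1) (tl \<pi>))) = \<pi>"
      using sorted_tail_ones[OF xs(3,4)] by (simp add: add_hook_def)
  qed
  have "sorted_wrt (\<ge>) (replicate m (1::nat))" for m by (induction m) auto
  then have "is_partition (add_hook k l \<rho>)" if "\<rho> \<in> box k l" for \<rho>
    using that unfolding add_hook_def is_partition_def box_def
    by (simp add: sorted_wrt_append sorted_wrt_map ball_Un)
  then show "add_hook k l ` box k l \<subseteq> full_box (Suc k) (Suc l)"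
    by (auto simp: full_box_def) (simp_all add: add_hook_def box_def)
  show "(\<lambda>\<pi>. filter (\<lambda>x. 0 < x) (map (\<lambda>x. x - 1) (tl \<pi>))) ` full_box (Suc k) (Suc l) \<subseteq> box k l"
  proof
    fix \<rho> assume "\<rho> \<in> (\<lambda>\<pi>. filter (\<lambda>x. 0 < x) (map (\<lambda>x. x - 1) (tl \<pi>))) ` full_box (Suc k) (Suc l)"
    then obtain xs where xs: "length xs = l" "sorted_wrt (\<ge>) xs" "\<forall>x\<in>set xs. x \<le> Suc k"
      and \<rho>: "\<rho> = filter (\<lambda>x. 0 < x) (map (\<lambda>x. x - 1) xs)"
      by (auto simp: full_box_def is_partition_def neq_Nil_conv)
    have "sorted_wrt (\<ge>) (map (\<lambda>x. x - 1) xs)"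
      using xs(2) by (auto simp: sorted_wrt_map intro: sorted_wrt_mono_rel[rotated])
    then have "sorted_wrt (\<ge>) \<rho>" unfolding \<rho> by (rule sorted_wrt_filter)
    moreover have "length \<rho> \<le> l"
      using \<rho> xs(1) by (metis length_filter_le length_map)
    moreover have "\<forall>p\<in>set \<rho>. 1 \<le> p \<and> p \<le> k" using \<rho> xs(3) by fastforce
    ultimately show "\<rho> \<in> box k l" by (auto simp: box_def is_partition_def)
  qed
qed

lemma sum_list_add_hook:
  assumes "length \<rho> \<le> l"
  shows "sum_list (add_hook k l \<rho>) = sum_list \<rho> + k + l + 1"
proof -
  have "sum_list (map Suc \<rho>) = sum_list \<rho> + length \<rho>" by (induction \<rho>) auto
  then show ?thesis using assms by (simp add: add_hook_def sum_list_replicate)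
qed

lemma all_pos_le_Suc: "(\<forall>j\<ge>1. j \<le> Suc l \<longrightarrow> Q j) \<longleftrightarrow> (\<forall>j\<le>l. Q (Suc j))"
  by (auto simp: Suc_le_eq gr0_conv_Suc)

text \<open>
  The Durfee square of \<open>\<rho>\<close> grows by one, its ranks move to the next index, and the new first rank is
  \<open>l - k\<close>. The condition at \<open>j + 1\<close> for the large diagram is therefore the condition at \<open>j\<close> for \<open>\<rho>\<close>
  with the slack changed by \<open>l - k - 1\<close>. The condition at \<open>1\<close> says that the new slack is nonnegative,
  which is how \<open>rank_cond\<close> treats the case \<open>j = 0\<close>.
\<close>

lemma rank_cond_add_hook:
  assumes \<rho>: "\<rho> \<in> box k l" and s: "0 \<le> s"
  shows "rank_cond s (add_hook k l \<rho>) \<longleftrightarrow> rank_cond (s + int l - int k - 1) \<rho>"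
proof -
  let ?\<pi> = "add_hook k l \<rho>"
  have p\<rho>: "is_partition \<rho>" and len: "length \<rho> \<le> l" using \<rho> by (auto simp: box_def)
  have p\<pi>: "is_partition ?\<pi>" and len\<pi>: "length ?\<pi> = Suc l"
    using bij_betwE[OF bij_betw_add_hook, of k l] \<rho> by (auto simp: full_box_def)
  have mins: "(\<Sum>p\<leftarrow>?\<pi>. min p (Suc j)) = min (Suc k) (Suc j) + (\<Sum>p\<leftarrow>\<rho>. min p j) + l" for j
  proof -
    have "(\<Sum>p\<leftarrow>map Suc \<rho>. min p (Suc j)) = (\<Sum>p\<leftarrow>\<rho>. min p j) + length \<rho>" by (induction \<rho>) auto
    then show ?thesis using len by (simp add: add_hook_def sum_list_replicate del: min_Suc_Suc)
  qed
  have takes: "sum_list (take (Suc j) ?\<pi>) = Suc k + j + sum_list (take j \<rho>)" if "j \<le> length \<rho>" for j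
  proof -
    have "sum_list (map Suc xs) = length xs + sum_list xs" for xs :: "nat list" by (induction xs) auto
    then show ?thesis using that by (simp add: add_hook_def take_map)
  qed
  have nth: "Suc j \<le> ?\<pi> ! j \<longleftrightarrow> j \<le> k \<and> (j = 0 \<or> j \<le> length \<rho> \<and> j \<le> \<rho> ! (j - 1))" if "j \<le> l" for j
  proof (cases j)
    case (Suc i)
    have "\<rho> ! i \<le> k" if "i < length \<rho>" using \<rho> that by (auto simp: box_def)
    then show ?thesis using Suc that by (auto simp: add_hook_def nth_append)
  qed (simp add: add_hook_def)
  have "rank_cond s ?\<pi> \<longleftrightarrow> (\<forall>j\<le>l. Suc j \<le> ?\<pi> ! j \<longrightarrow>
      int (Suc j) + int (sum_list (take (Suc j) ?\<pi>)) \<le> s + int (\<Sum>p\<leftarrow>?\<pi>. min p (Suc j)))"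
    unfolding rank_cond_iff[OF p\<pi>] len\<pi> all_pos_le_Suc using s by simp
  also have "\<dots> \<longleftrightarrow> (\<forall>j\<le>length \<rho>. j = 0 \<or> j \<le> \<rho> ! (j - 1) \<longrightarrow>
      int j + int (sum_list (take j \<rho>)) \<le> (s + int l - int k - 1) + int (\<Sum>p\<leftarrow>\<rho>. min p j))"
  proof (intro iffI allI impI)
    fix j
    assume H: "\<forall>j\<le>l. Suc j \<le> ?\<pi> ! j \<longrightarrow>
      int (Suc j) + int (sum_list (take (Suc j) ?\<pi>)) \<le> s + int (\<Sum>p\<leftarrow>?\<pi>. min p (Suc j))"
      and j: "j \<le> length \<rho>" "j = 0 \<or> j \<le> \<rho> ! (j - 1)"
    have "j \<le> k"
    proof (cases j)
      case (Suc i)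
      then have "\<rho> ! i \<le> k" using j \<rho> by (auto simp: box_def)
      then show ?thesis using Suc j by simp
    qed simp
    then have "Suc j \<le> ?\<pi> ! j" using nth[of j] j len by auto
    then have "int (Suc j) + int (sum_list (take (Suc j) ?\<pi>)) \<le> s + int (\<Sum>p\<leftarrow>?\<pi>. min p (Suc j))"
      using H j len by auto
    then show "int j + int (sum_list (take j \<rho>)) \<le> (s + int l - int k - 1) + int (\<Sum>p\<leftarrow>\<rho>. min p j)"
      unfolding mins takes[OF j(1)] using \<open>j \<le> k\<close> by simp
  next
    fix j
    assume H: "\<forall>j\<le>length \<rho>. j = 0 \<or> j \<le> \<rho> ! (j - 1) \<longrightarrow>
      int j + int (sum_list (take j \<rho>)) \<le> (s + int l - int k - 1) + int (\<Sum>p\<leftarrow>\<rho>. min p j)"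
      and j: "j \<le> l" "Suc j \<le> ?\<pi> ! j"
    then have j': "j \<le> k" "j \<le> length \<rho>" "j = 0 \<or> j \<le> \<rho> ! (j - 1)" using nth[OF j(1)] by auto
    then have "int j + int (sum_list (take j \<rho>)) \<le> (s + int l - int k - 1) + int (\<Sum>p\<leftarrow>\<rho>. min p j)"
      using H by blast
    then show "int (Suc j) + int (sum_list (take (Suc j) ?\<pi>)) \<le> s + int (\<Sum>p\<leftarrow>?\<pi>. min p (Suc j))"
      unfolding mins takes[OF j'(2)] using j'(1) by simp
  qed
  also have "\<dots> \<longleftrightarrow> rank_cond (s + int l - int k - 1) \<rho>"
    unfolding rank_cond_iff[OF p\<rho>]
  proof (safe, goal_cases)
    case 1
    then show ?case by (auto dest: spec[of _ 0])
  next
    case (4 j)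
    then show ?case by (cases "j = 0") auto
  qed auto
  finally show ?thesis .
qed

text \<open>
  Only the parity of the size of a partition matters for degree sequences. Keeping the parity instead
  of the size saves a factor \<open>n\<^sup>2\<close> in the table, which pays for slacks as large as \<open>n\<^sup>2\<close>.
\<close>

definition parity_count :: "nat \<Rightarrow> nat \<Rightarrow> int \<Rightarrow> nat \<Rightarrow> int" where
  "parity_count k l s b = int (card {\<pi> \<in> box k l. rank_cond s \<pi> \<and> sum_list \<pi> mod 2 = b})"

lemma card_full_box:
  assumes "0 \<le> s"
  shows "card {\<pi> \<in> full_box (Suc k) (Suc l). rank_cond s \<pi> \<and> Q (sum_list \<pi>)} =
    card {\<rho> \<in> box k l. rank_cond (s + int l - int k - 1) \<rho> \<and> Q (sum_list \<rho> + k + l + 1)}"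
proof -
  have "bij_betw (add_hook k l)
      {\<rho> \<in> box k l. rank_cond (s + int l - int k - 1) \<rho> \<and> Q (sum_list \<rho> + k + l + 1)}
      {\<pi> \<in> full_box (Suc k) (Suc l). rank_cond s \<pi> \<and> Q (sum_list \<pi>)}"
  proof (rule bij_betw_Collect[OF bij_betw_add_hook])
    fix \<rho> assume "\<rho> \<in> box k l"
    moreover from this have "length \<rho> \<le> l" by (simp add: box_def)
    ultimately show "rank_cond s (add_hook k l \<rho>) \<and> Q (sum_list (add_hook k l \<rho>)) \<longleftrightarrow>
        rank_cond (s + int l - int k - 1) \<rho> \<and> Q (sum_list \<rho> + k + l + 1)"
      using assms by (simp add: rank_cond_add_hook sum_list_add_hook)
  qed
  then show ?thesis by (rule bij_betw_same_card[symmetric])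
qed

lemma parity_count_neg: "s < 0 \<Longrightarrow> parity_count k l s b = 0"
  by (simp add: parity_count_def rank_cond_def)

lemma parity_count_degenerate:
  assumes "k = 0 \<or> l = 0"
  shows "parity_count k l s b = (if 0 \<le> s \<and> b = 0 then 1 else 0)"
proof -
  have "\<pi> = []" if "\<pi> \<in> box k l" for \<pi>
    using that assms by (cases \<pi>) (auto simp: box_def is_partition_def)
  moreover have "[] \<in> box k l" by (simp add: box_def is_partition_def)
  ultimately have eq: "box k l = {[]}" by blast
  have "{\<pi> \<in> box k l. rank_cond s \<pi> \<and> sum_list \<pi> mod 2 = b} = (if 0 \<le> s \<and> b = 0 then {[]} else {})"
    unfolding eq by (cases "0 \<le> s"; cases "b = 0") auto
  then show ?thesis by (simp add: parity_count_def)
qed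

lemma mod_2_eq_iff: "x mod 2 = y mod 2 \<longleftrightarrow> (even x \<longleftrightarrow> even y)" for x y :: nat
  by (simp add: mod2_eq_if)

text \<open>
  The recurrence of Barnes and Savage: inclusion and exclusion over the partitions that avoid the
  last column or the last row of the box; those that reach both lose their outer hook.
\<close>

lemma parity_count_rec:
  assumes "0 \<le> s" "b < 2"
  shows "parity_count (Suc k) (Suc l) s b =
    parity_count k (Suc l) s b + parity_count (Suc k) l s b - parity_count k l s b +
    parity_count k l (s + int l - int k - 1) ((b + k + l + 1) mod 2)"
proof -
  define S where "S A = {\<pi> \<in> A. rank_cond s \<pi> \<and> sum_list \<pi> mod 2 = b}" for A
  have hd_max: "p \<le> hd \<pi>" if "is_partition \<pi>" "p \<in> set \<pi>" for p \<pi>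
    using that by (cases \<pi>) (auto simp: is_partition_def)
  have split: "box (Suc k) (Suc l) = (box k (Suc l) \<union> box (Suc k) l) \<union> full_box (Suc k) (Suc l)"
    (is "_ = ?R")
  proof
    show "box (Suc k) (Suc l) \<subseteq> ?R"
    proof
      fix \<pi> assume \<pi>: "\<pi> \<in> box (Suc k) (Suc l)"
      show "\<pi> \<in> ?R"
      proof (cases "\<pi> = [] \<or> length \<pi> \<le> l")
        case True
        then show ?thesis using \<pi> by (auto simp: box_def)
      next
        case long: False
        then have "hd \<pi> \<le> Suc k" "length \<pi> = Suc l" using \<pi> by (auto simp: box_def)
        then show ?thesis using \<pi> hd_max[of \<pi>] long
          by (cases "hd \<pi> = Suc k") (fastforce simp: box_def full_box_def)+
      qed
    qed
    show "?R \<subseteq> box (Suc k) (Suc l)"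
      using hd_max by (fastforce simp: box_def full_box_def)
  qed
  have disj: "(box k (Suc l) \<union> box (Suc k) l) \<inter> full_box (Suc k) (Suc l) = {}"
    using hd_in_set by (fastforce simp: box_def full_box_def)
  have fin: "finite (box k' l')" "finite (full_box (Suc k) (Suc l))" for k' l'
    using finite_box[of "Suc k" "Suc l"] finite_box split by auto
  have inter: "box k (Suc l) \<inter> box (Suc k) l = box k l" by (auto simp: box_def)
  have arith: "a = u + f \<Longrightarrow> u + i = x + y \<Longrightarrow> f = g \<Longrightarrow> int a = int x + int y - int i + int g"
    for a u f i x y g :: nat
    by linarith
  have S_Un: "S (A \<union> B) = S A \<union> S B" and S_Int: "S A \<inter> S B = S (A \<inter> B)"
    and S_fin: "finite A \<Longrightarrow> finite (S A)" and S_empty: "S {} = {}" for A B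
    by (auto simp: S_def)
  have "card (S (box (Suc k) (Suc l))) =
      card (S (box k (Suc l)) \<union> S (box (Suc k) l)) + card (S (full_box (Suc k) (Suc l)))"
    unfolding split S_Un
    by (rule card_Un_disjoint) (simp_all add: S_fin fin S_Int disj S_empty flip: S_Un)
  moreover have "card (S (box k (Suc l)) \<union> S (box (Suc k) l)) + card (S (box k l)) =
      card (S (box k (Suc l))) + card (S (box (Suc k) l))"
    using card_Un_Int[of "S (box k (Suc l))" "S (box (Suc k) l)"] by (simp add: S_Int inter S_fin fin)
  moreover have "card (S (full_box (Suc k) (Suc l))) = card {\<rho> \<in> box k l.
      rank_cond (s + int l - int k - 1) \<rho> \<and> sum_list \<rho> mod 2 = (b + k + l + 1) mod 2}"
  proof -
    have b: "b mod 2 = b" using assms(2) by simp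
    have "(x + k + l + 1) mod 2 = b mod 2 \<longleftrightarrow> x mod 2 = (b + k + l + 1) mod 2" for x
      unfolding mod_2_eq_iff by auto
    then have "(x + k + l + 1) mod 2 = b \<longleftrightarrow> x mod 2 = (b + k + l + 1) mod 2" for x
      unfolding b .
    then show ?thesis
      unfolding S_def card_full_box[OF assms(1), of k l "\<lambda>x. x mod 2 = b"] by (simp only:)
  qed
  ultimately have "int (card (S (box (Suc k) (Suc l)))) = int (card (S (box k (Suc l)))) +
      int (card (S (box (Suc k) l))) - int (card (S (box k l))) +
      parity_count k l (s + int l - int k - 1) ((b + k + l + 1) mod 2)"
    unfolding parity_count_def by (rule arith)
  then show ?thesis by (simp only: S_def parity_count_def)
qed

section \<open>The counting formula\<close>

lemma Ps_eq_box:
  "Ps N (int k) (int l) s = {\<pi> \<in> box k l. rank_cond s \<pi> \<and> int (sum_list \<pi>) = N}"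
proof (cases "s < 0")
  case False
  have "(\<forall>j\<in>{1..durfee \<pi>}. s + (\<Sum>i=1..j. rank_at \<pi> i) \<ge> int j) \<longleftrightarrow> rank_cond s \<pi>" for \<pi>
    using False by (simp add: rank_cond_def)
  then show ?thesis using False unfolding Ps_def P_def box_def by auto
qed (simp add: Ps_def rank_cond_def)

lemma D_eq: "D n = {\<pi>. is_partition \<pi> \<and> length \<pi> = n \<and> even (sum_list \<pi>) \<and> rank_cond 0 \<pi>}"
proof -
  have "(\<exists>(V :: nat set) E. simple_graph V E \<and> card V = n \<and> mset \<pi> = degree_multiset V E) \<longleftrightarrow>
      even (sum_list \<pi>) \<and> rank_cond 0 \<pi>" if "is_partition \<pi>" "length \<pi> = n" for \<pi>
  proof -
    have "sorted_wrt (\<ge>) \<pi>" using that by (simp add: is_partition_def)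
    note graphic_iff[OF this, unfolded that(2)]
    moreover have "int j + int a \<le> 0 + int b \<longleftrightarrow> j + a \<le> b" for j a b by linarith
    ultimately show ?thesis by (simp only: rank_cond_iff[OF that(1)] that(2) order_refl simp_thms)
  qed
  then show ?thesis unfolding D_def is_partition_def by blast
qed

text \<open>
  A degree sequence of length \<open>m + 1\<close> has a full first column. Without its outer hook it is an
  arbitrary partition in a box, with slack \<open>m - k - 1\<close>, whose sign encodes that a degree is at most
  \<open>m\<close>.
\<close>

lemma card_D:
  "card (D (Suc m)) = (\<Sum>k<m. card {\<rho> \<in> box k m. rank_cond (int m - int k - 1) \<rho> \<and>
     even (sum_list \<rho> + k + m + 1)})"
proof -
  let ?A = "\<lambda>k. {\<pi> \<in> full_box (Suc k) (Suc m). rank_cond 0 \<pi> \<and> even (sum_list \<pi>)}"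
  have "D (Suc m) = (\<Union>k<m. ?A k)"
  proof
    show "D (Suc m) \<subseteq> (\<Union>k<m. ?A k)"
    proof
      fix \<pi> assume "\<pi> \<in> D (Suc m)"
      then have \<pi>: "is_partition \<pi>" "length \<pi> = Suc m" "even (sum_list \<pi>)" "rank_cond 0 \<pi>"
        by (auto simp: D_eq)
      then obtain k where "hd \<pi> = Suc k"
        by (cases \<pi>) (auto simp: is_partition_def Suc_le_eq gr0_conv_Suc)
      then have full: "\<pi> \<in> full_box (Suc k) (Suc m)" using \<pi> by (auto simp: full_box_def)
      then obtain \<rho> where "\<rho> \<in> box k m" "\<pi> = add_hook k m \<rho>"
        using bij_betw_add_hook by (metis bij_betw_imp_surj_on imageE)
      then have "rank_cond (int m - int k - 1) \<rho>" using \<pi>(4) rank_cond_add_hook[of \<rho> k m 0] by simp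
      then have "k < m" by (simp add: rank_cond_def)
      then show "\<pi> \<in> (\<Union>k<m. ?A k)" using full \<pi> by blast
    qed
  qed (auto simp: D_eq full_box_def)
  moreover have "card (\<Union>k<m. ?A k) = (\<Sum>k<m. card (?A k))"
  proof (rule card_UN_disjoint)
    have "finite (full_box (Suc k) (Suc m))" for k
      using bij_betw_finite[OF bij_betw_add_hook] finite_box by blast
    then show "\<forall>k\<in>{..<m}. finite (?A k)" by simp
  qed (auto simp: full_box_def)
  ultimately show ?thesis
    using card_full_box[of 0 _ m even] by simp
qed

lemma sum_list_box:
  assumes "\<rho> \<in> box k l"
  shows "sum_list \<rho> \<le> k * l"
proof -
  have "sum_list \<rho> \<le> length \<rho> * k" using assms by (induction \<rho>) (auto simp: box_def is_partition_def)
  also have "\<dots> \<le> k * l" using assms by (simp add: box_def)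
  finally show ?thesis .
qed

theorem card_D_Ps:
  assumes "n \<ge> 1"
  shows "card (D n) = (\<Sum>N\<in>I_even n. \<Sum>k=1..int n - 1.
    card (Ps (N - k - int n + 1) (k - 1) (int n - 1) (int n - k - 1)))"
proof -
  obtain m where n: "n = Suc m" using assms by (cases n) auto
  have fin: "finite (I_even n)"
    by (rule finite_subset[of _ "{int n..int n * (int n - 1)}"]) (auto simp: I_even_def)
  have block: "(\<Sum>N\<in>I_even n. card (Ps (N - int k - int m - 1) (int k) (int m) (int m - int k - 1))) =
      card {\<rho> \<in> box k m. rank_cond (int m - int k - 1) \<rho> \<and> even (sum_list \<rho> + k + m + 1)}"
    if "k < m" for k
  proof -
    let ?B = "\<lambda>N. Ps (N - int k - int m - 1) (int k) (int m) (int m - int k - 1)"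
    have "(\<Sum>N\<in>I_even n. card (?B N)) = card (\<Union>N\<in>I_even n. ?B N)"
      using fin finite_box by (intro card_UN_disjoint[symmetric]) (auto simp: Ps_eq_box)
    also have "(\<Union>N\<in>I_even n. ?B N) =
        {\<rho> \<in> box k m. rank_cond (int m - int k - 1) \<rho> \<and> even (sum_list \<rho> + k + m + 1)}" (is "_ = ?R")
    proof
      show "?R \<subseteq> (\<Union>N\<in>I_even n. ?B N)"
      proof
        fix \<rho> assume \<rho>: "\<rho> \<in> ?R"
        let ?N = "int (sum_list \<rho> + k + m + 1)"
        \<comment> \<open>The upper end of \<open>I_even n\<close> cuts nothing off: it is reached by the full box.\<close>
        have "k * m + k + m + 1 = Suc k * Suc m" by simp
        then have "sum_list \<rho> + k + m + 1 \<le> Suc k * Suc m" using sum_list_box[of \<rho> k m] \<rho> by simp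
        also have "\<dots> \<le> m * Suc m" using that by (intro mult_le_mono1) simp
        finally have "?N \<le> int (m * Suc m)" by (simp only: of_nat_le_iff)
        then have "?N \<in> I_even n" using \<rho> n by (auto simp: I_even_def algebra_simps)
        then show "\<rho> \<in> (\<Union>N\<in>I_even n. ?B N)" using \<rho> by (intro UN_I[of ?N]) (auto simp: Ps_eq_box)
      qed
      show "(\<Union>N\<in>I_even n. ?B N) \<subseteq> ?R"
      proof
        fix \<rho> assume "\<rho> \<in> (\<Union>N\<in>I_even n. ?B N)"
        then obtain N where N: "even N" "\<rho> \<in> box k m" "rank_cond (int m - int k - 1) \<rho>"
          "int (sum_list \<rho>) = N - int k - int m - 1" by (auto simp: Ps_eq_box I_even_def)
        then have "int (sum_list \<rho> + k + m + 1) = N" by simp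
        then have "even (int (sum_list \<rho> + k + m + 1))" using N(1) by (simp only:)
        then show "\<rho> \<in> ?R" using N by (simp only: even_of_nat mem_Collect_eq simp_thms)
      qed
    qed
    finally show ?thesis .
  qed
  have "(\<Sum>N\<in>I_even n. \<Sum>k=1..int n - 1.
      card (Ps (N - k - int n + 1) (k - 1) (int n - 1) (int n - k - 1))) =
    (\<Sum>N\<in>I_even n. \<Sum>k<m. card (Ps (N - int k - int m - 1) (int k) (int m) (int m - int k - 1)))"
  proof (intro sum.cong refl)
    fix N
    show "(\<Sum>k=1..int n - 1. card (Ps (N - k - int n + 1) (k - 1) (int n - 1) (int n - k - 1))) =
      (\<Sum>k<m. card (Ps (N - int k - int m - 1) (int k) (int m) (int m - int k - 1)))"
      by (rule sum.reindex_bij_witness[of _ "\<lambda>k. int k + 1" "\<lambda>k. nat (k - 1)"])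
        (auto simp: n algebra_simps)
  qed
  also have "\<dots> = (\<Sum>k<m. \<Sum>N\<in>I_even n.
      card (Ps (N - int k - int m - 1) (int k) (int m) (int m - int k - 1)))"
    by (rule sum.swap)
  also have "\<dots> = card (D n)" using block by (simp add: n card_D)
  finally show ?thesis by simp
qed

corollary card_D_parity_count:
  "int (card (D (Suc m))) = (\<Sum>k<m. parity_count k m (int m - int k - 1) ((k + m + 1) mod 2))"
proof -
  have "even (x + k + m + 1) \<longleftrightarrow> x mod 2 = (k + m + 1) mod 2" for x k :: nat
    unfolding mod_2_eq_iff by auto
  then show ?thesis by (simp add: card_D parity_count_def)
qed

section \<open>Time, space and loops\<close>

lemma card_UN_le_sum_list:
  assumes "\<And>e. e \<in> set es \<Longrightarrow> finite (f e) \<and> card (f e) \<le> g e"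
  shows "finite (\<Union>e\<in>set es. f e) \<and> card (\<Union>e\<in>set es. f e) \<le> (\<Sum>e\<leftarrow>es. g e)"
  using assms
proof (induction es)
  case (Cons e es)
  have "card (f e \<union> (\<Union>e\<in>set es. f e)) \<le> card (f e) + card (\<Union>e\<in>set es. f e)"
    by (rule card_Un_le)
  also have "\<dots> \<le> g e + (\<Sum>e\<leftarrow>es. g e)"
    using Cons by (intro add_mono) auto
  finally show ?case using Cons by auto
qed simp

lemma expr_cells_cost: "finite (expr_cells e \<sigma>) \<and> card (expr_cells e \<sigma>) \<le> expr_cost e"
proof (induction e)
  case (Read a es)
  have "finite (\<Union>e\<in>set es. expr_cells e \<sigma>) \<and>
      card (\<Union>e\<in>set es. expr_cells e \<sigma>) \<le> (\<Sum>e\<leftarrow>es. expr_cost e)"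
    using Read by (intro card_UN_le_sum_list)
  then show ?case using card_insert_le_m1 by (auto simp: card_insert_if)
next
  case (Add e f)
  then show ?case using card_Un_le[of "expr_cells e \<sigma>" "expr_cells f \<sigma>"] by auto
next
  case (Sub e f)
  then show ?case using card_Un_le[of "expr_cells e \<sigma>" "expr_cells f \<sigma>"] by auto
qed simp

lemma test_cells_cost: "finite (test_cells b \<sigma>) \<and> card (test_cells b \<sigma>) \<le> test_cost b"
proof (cases b)
  case (Less e f)
  then show ?thesis
    using expr_cells_cost[of e \<sigma>] expr_cells_cost[of f \<sigma>]
      card_Un_le[of "expr_cells e \<sigma>" "expr_cells f \<sigma>"] by simp
next
  case (Equal e f)
  then show ?thesis
    using expr_cells_cost[of e \<sigma>] expr_cells_cost[of f \<sigma>]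
      card_Un_le[of "expr_cells e \<sigma>" "expr_cells f \<sigma>"] by simp
qed

text \<open>
  Every cell that is touched has been paid for by the access to it. So a bound on time is a bound on
  space.
\<close>

lemma exec_space_le_time: "exec p \<sigma> t F \<tau> \<Longrightarrow> finite F \<and> card F \<le> t"
proof (induction rule: exec.induct)
  case (exec_Store c a \<sigma> es e)
  let ?A = "\<Union>e\<in>set es. expr_cells e \<sigma>"
  have A: "finite ?A \<and> card ?A \<le> (\<Sum>e\<leftarrow>es. expr_cost e)"
    using expr_cells_cost by (intro card_UN_le_sum_list)
  have "card (insert c (?A \<union> expr_cells e \<sigma>)) \<le> Suc (card (?A \<union> expr_cells e \<sigma>))"
    by (rule card_insert_le_m1[of "Suc _", simplified]) simp
  also have "\<dots> \<le> Suc (card ?A + card (expr_cells e \<sigma>))" using card_Un_le by simp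
  finally show ?case using A expr_cells_cost[of e \<sigma>] by auto
next
  case (exec_Seq p \<sigma> t F \<sigma>' q u G \<tau>)
  then show ?case using card_Un_le[of F G] by auto
next
  case (exec_Branch_True b \<sigma> p t F \<tau> q)
  then show ?case using card_Un_le[of "test_cells b \<sigma>" F] test_cells_cost[of b \<sigma>] by auto
next
  case (exec_Branch_False b \<sigma> q t F \<tau> p)
  then show ?case using card_Un_le[of "test_cells b \<sigma>" F] test_cells_cost[of b \<sigma>] by auto
next
  case (exec_While_False b \<sigma> p)
  then show ?case using test_cells_cost by simp
next
  case (exec_While_True b \<sigma> p t F \<sigma>' u G \<tau>)
  then show ?case
    using card_Un_le[of "test_cells b \<sigma> \<union> F" G] card_Un_le[of "test_cells b \<sigma>" F]
      test_cells_cost[of b \<sigma>] by auto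
qed simp

text \<open>
  Total correctness with a time bound, in the style of weakest preconditions.
\<close>

definition runs :: "prog \<Rightarrow> state \<Rightarrow> nat \<Rightarrow> (state \<Rightarrow> bool) \<Rightarrow> bool" where
  "runs p \<sigma> c Q \<longleftrightarrow> (\<exists>t F \<tau>. exec p \<sigma> t F \<tau> \<and> t \<le> c \<and> Q \<tau>)"

lemma runs_mono:
  assumes "runs p \<sigma> c Q" "c \<le> c'" "\<And>\<tau>. Q \<tau> \<Longrightarrow> Q' \<tau>"
  shows "runs p \<sigma> c' Q'"
  using assms unfolding runs_def by (meson le_trans)

lemma runs_Store:
  assumes "Q (\<sigma>((a, map (\<lambda>e. expr_val e \<sigma>) es) := expr_val e \<sigma>))"
    and "1 + (\<Sum>e\<leftarrow>es. expr_cost e) + expr_cost e \<le> c"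
  shows "runs (Store a es e) \<sigma> c Q"
  using assms exec_Store[OF refl] unfolding runs_def by blast

lemma runs_Seq:
  assumes "runs p \<sigma> c (\<lambda>\<tau>. runs q \<tau> d Q)"
  shows "runs (Seq p q) \<sigma> (c + d) Q"
proof -
  obtain t F \<sigma>' u G \<tau> where
    "exec p \<sigma> t F \<sigma>'" "t \<le> c" "exec q \<sigma>' u G \<tau>" "u \<le> d" "Q \<tau>"
    using assms unfolding runs_def by blast
  then show ?thesis unfolding runs_def using exec_Seq add_mono by blast
qed

lemma runs_Branch:
  assumes "test_val b \<sigma> \<Longrightarrow> runs p \<sigma> c Q" "\<not> test_val b \<sigma> \<Longrightarrow> runs q \<sigma> c Q"
  shows "runs (Branch b p q) \<sigma> (test_cost b + c) Q"
proof (cases "test_val b \<sigma>")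
  case True
  then show ?thesis using assms(1) exec_Branch_True[OF True] unfolding runs_def
    by (meson add_left_mono)
next
  case False
  then show ?thesis using assms(2) exec_Branch_False[OF False] unfolding runs_def
    by (meson add_left_mono)
qed

definition for_loop :: "string \<Rightarrow> expr \<Rightarrow> prog \<Rightarrow> prog" where
  "for_loop x b p = Seq (Store x [] (Const 0))
     (While (Less (Read x []) b) (Seq p (Store x [] (Add (Read x []) (Const 1)))))"

text \<open>
  The invariant is stated for the moment before the body with counter \<open>i\<close>. The test costs
  \<open>expr_cost b + 2\<close> and the increment \<open>3\<close>. The factor \<open>m + 1\<close> in place of \<open>m\<close> absorbs the initial
  assignment and the last test.
\<close>

lemma runs_for_loop:
  assumes init: "I 0 (\<sigma>((x, []) := 0))"
    and bound: "\<And>i \<tau>. I i \<tau> \<Longrightarrow> expr_val b \<tau> = int m"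
    and step: "\<And>i \<tau>. i < m \<Longrightarrow> I i \<tau> \<Longrightarrow> \<tau> (x, []) = int i \<Longrightarrow>
      runs p \<tau> c (\<lambda>\<tau>'. \<tau>' (x, []) = int i \<and> I (Suc i) (\<tau>'((x, []) := int (Suc i))))"
  shows "runs (for_loop x b p) \<sigma> ((m + 1) * (c + expr_cost b + 6)) (I m)"
proof -
  let ?inc = "Store x [] (Add (Read x []) (Const 1))"
  let ?w = "While (Less (Read x []) b) (Seq p ?inc)"
  let ?c = "c + expr_cost b + 6"
  have loop: "runs ?w \<tau> (k * ?c + 2 + expr_cost b) (I m)"
    if "I (m - k) \<tau>" "\<tau> (x, []) = int (m - k)" "k \<le> m" for k \<tau>
    using that
  proof (induction k arbitrary: \<tau>)
    case 0
    have "\<not> test_val (Less (Read x []) b) \<tau>" using 0 bound[OF 0(1)] by simp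
    from exec_While_False[OF this] show ?case unfolding runs_def using 0 by fastforce
  next
    case (Suc k)
    let ?i = "m - Suc k"
    have i: "?i < m" "Suc ?i = m - k" using Suc.prems by auto
    have t: "test_val (Less (Read x []) b) \<tau>"
      using Suc.prems bound[OF Suc.prems(1)] i by simp
    have "runs (Seq p ?inc) \<tau> (c + 3)
        (\<lambda>\<tau>'. I (m - k) \<tau>' \<and> \<tau>' (x, []) = int (m - k))"
    proof (rule runs_Seq, rule runs_mono[OF step[OF i(1) Suc.prems(1,2)]])
      fix \<tau>' assume \<tau>': "\<tau>' (x, []) = int ?i \<and> I (Suc ?i) (\<tau>'((x, []) := int (Suc ?i)))"
      then show "runs ?inc \<tau>' 3 (\<lambda>\<tau>'. I (m - k) \<tau>' \<and> \<tau>' (x, []) = int (m - k))"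
        using i(2) by (intro runs_Store) (auto simp: add.commute)
    qed simp
    then obtain t1 F1 \<tau>1 where 1: "exec (Seq p ?inc) \<tau> t1 F1 \<tau>1" "t1 \<le> c + 3"
      "I (m - k) \<tau>1" "\<tau>1 (x, []) = int (m - k)"
      unfolding runs_def by blast
    obtain t2 F2 \<tau>2 where 2: "exec ?w \<tau>1 t2 F2 \<tau>2" "t2 \<le> k * ?c + 2 + expr_cost b" "I m \<tau>2"
      using Suc.IH[OF 1(3,4)] Suc.prems(3) unfolding runs_def by auto
    have "test_cost (Less (Read x []) b) + t1 + t2 \<le> Suc k * ?c + 2 + expr_cost b"
      using 1(2) 2(2) by simp
    then show ?case unfolding runs_def using exec_While_True[OF t 1(1) 2(1)] 2(3) by blast
  qed
  have "runs (for_loop x b p) \<sigma> (1 + (m * ?c + 2 + expr_cost b)) (I m)"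
    unfolding for_loop_def
    by (intro runs_Seq runs_Store) (use init loop[of m] in simp_all)
  then show ?thesis by (rule runs_mono) auto
qed

section \<open>The program\<close>

abbreviation "v_n \<equiv> Read ''in'' []"
abbreviation "v_k \<equiv> Read ''k'' []"
abbreviation "v_l \<equiv> Read ''l'' []"
abbreviation "v_s \<equiv> Read ''s'' []"

text \<open>
  The recurrence for \<open>parity_count\<close>. The hook removed from a \<open>k\<close> by \<open>l\<close> box has \<open>k + l - 1\<close> dots, and
  \<open>h\<close> is an index with the parity of \<open>b + k + l - 1\<close>. Since there is no division, parities are
  looked up in the array \<open>par\<close>. A read at a negative slack finds the initial value \<open>0\<close>, as it should.
\<close>

definition table_entry :: "int \<Rightarrow> expr \<Rightarrow> prog" where
  "table_entry b h = Store ''t'' [v_k, v_l, v_s, Const b]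
     (Add (Sub (Add (Read ''t'' [Sub v_k (Const 1), v_l, v_s, Const b])
                    (Read ''t'' [v_k, Sub v_l (Const 1), v_s, Const b]))
               (Read ''t'' [Sub v_k (Const 1), Sub v_l (Const 1), v_s, Const b]))
          (Read ''t'' [Sub v_k (Const 1), Sub v_l (Const 1),
             Sub (Sub (Add v_s v_l) v_k) (Const 1), Read ''par'' [h]]))"

definition table_step :: prog where
  "table_step =
     (let base = Seq (Store ''t'' [v_k, v_l, v_s, Const 0] (Const 1))
                     (Store ''t'' [v_k, v_l, v_s, Const 1] (Const 0))
      in Branch (Equal v_k (Const 0)) base (Branch (Equal v_l (Const 0)) base
           (Seq (table_entry 0 (Sub (Add v_k v_l) (Const 1))) (table_entry 1 (Add v_k v_l)))))"

definition par_loop :: prog where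
  "par_loop = for_loop ''i'' (Add v_n v_n)
     (Store ''par'' [Add (Read ''i'' []) (Const 1)] (Sub (Const 1) (Read ''par'' [Read ''i'' []])))"

definition square_loop :: prog where
  "square_loop = for_loop ''i'' v_n (Store ''m'' [] (Add (Read ''m'' []) v_n))"

definition table_loop :: prog where
  "table_loop = for_loop ''l'' v_n (for_loop ''k'' v_n (for_loop ''s'' (Read ''m'' []) table_step))"

text \<open>
  The index \<open>k = n - 1\<close> addresses the slack \<open>-1\<close> and adds \<open>0\<close>.
\<close>

definition sum_loop :: prog where
  "sum_loop = for_loop ''k'' v_n (Store ''out'' [] (Add (Read ''out'' [])
     (Read ''t'' [v_k, Sub v_n (Const 1), Sub (Sub v_n v_k) (Const 2), Read ''par'' [Add v_k v_n]])))"

definition count_D :: prog where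
  "count_D = Seq (Seq par_loop square_loop) (Seq table_loop sum_loop)"

definition globals :: "nat \<Rightarrow> state \<Rightarrow> bool" where
  "globals n \<sigma> \<longleftrightarrow> \<sigma> (''in'', []) = int n \<and> \<sigma> (''m'', []) = int (n * n) \<and> \<sigma> (''out'', []) = 0 \<and>
     (\<forall>i\<le>2 * n. \<sigma> (''par'', [int i]) = int (i mod 2))"

text \<open>
  The slack grows by at most \<open>n\<close> from one box to the next smaller one, so the entries for \<open>l\<close> depend
  on larger slacks at \<open>l - 1\<close>. The program fills \<open>0 \<le> s < n\<^sup>2\<close> for every \<open>l\<close>, and only the entries
  with \<open>s < n\<^sup>2 - n l\<close> are claimed to be correct; those beyond may rest on cells that were never
  written. For \<open>l = n - 1\<close> this leaves the slacks below \<open>n\<close>, which are the ones summed at the end.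
\<close>

definition table_ok :: "nat \<Rightarrow> (nat \<Rightarrow> nat \<Rightarrow> int \<Rightarrow> bool) \<Rightarrow> state \<Rightarrow> bool" where
  "table_ok n R \<sigma> \<longleftrightarrow> (\<forall>k<n. \<forall>l<n. \<forall>s. \<forall>b<2.
     s + int (n * l) < int (n * n) \<longrightarrow> s < 0 \<or> R k l s \<longrightarrow>
     \<sigma> (''t'', [int k, int l, s, int b]) = parity_count k l s b)"

lemma globals_upd:
  "x \<notin> {''in'', ''m'', ''out''} \<Longrightarrow> globals n (\<sigma>((x, []) := v)) = globals n \<sigma>"
  "globals n (\<sigma>((''t'', ks) := v)) = globals n \<sigma>"
  by (auto simp: globals_def)

lemma table_ok_scalar_upd: "table_ok n R (\<sigma>((x, []) := v)) = table_ok n R \<sigma>"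
  by (auto simp: table_ok_def)

lemma table_ok_mono:
  assumes "table_ok n R \<sigma>"
    and "\<And>k l s. k < n \<Longrightarrow> l < n \<Longrightarrow> 0 \<le> s \<Longrightarrow> s < int (n * n) \<Longrightarrow> R' k l s \<Longrightarrow> R k l s"
  shows "table_ok n R' \<sigma>"
  unfolding table_ok_def
proof (intro allI impI)
  fix k l s b assume a: "k < n" "l < n" "b < (2::nat)" "s + int (n * l) < int (n * n)" "s < 0 \<or> R' k l s"
  have "0 \<le> int (n * l)" by simp
  then have "s < int (n * n)" using a(4) by linarith
  then have "s < 0 \<or> R k l s" using a assms(2)[of k l s] by linarith
  then show "\<sigma> (''t'', [int k, int l, s, int b]) = parity_count k l s b"
    using assms(1) a unfolding table_ok_def by blast
qed

lemma table_ok_extend: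
  assumes "table_ok n R \<sigma>"
    and "\<And>b. b < 2 \<Longrightarrow> s + int (n * l) < int (n * n) \<Longrightarrow> v b = parity_count k l s b"
  shows "table_ok n (\<lambda>k' l' s'. R k' l' s' \<or> k' = k \<and> l' = l \<and> s' = s)
    (\<sigma>((''t'', [int k, int l, s, 0]) := v 0, (''t'', [int k, int l, s, 1]) := v 1))"
  unfolding table_ok_def
proof (intro allI impI)
  fix k' l' s' b
  let ?\<sigma> = "\<sigma>((''t'', [int k, int l, s, 0]) := v 0, (''t'', [int k, int l, s, 1]) := v 1)"
  assume a: "k' < n" "l' < n" "b < (2::nat)" "s' + int (n * l') < int (n * n)"
    "s' < 0 \<or> R k' l' s' \<or> k' = k \<and> l' = l \<and> s' = s"
  have b: "b = 0 \<or> b = 1" using a(3) by auto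
  show "?\<sigma> (''t'', [int k', int l', s', int b]) = parity_count k' l' s' b"
  proof (cases "k' = k \<and> l' = l \<and> s' = s")
    case True
    then show ?thesis using a(4) b assms(2)[of b] by auto
  next
    case False
    then have "?\<sigma> (''t'', [int k', int l', s', int b]) = \<sigma> (''t'', [int k', int l', s', int b])" by auto
    then show ?thesis using assms(1) a False unfolding table_ok_def by metis
  qed
qed

definition entry_inv :: "nat \<Rightarrow> nat \<Rightarrow> nat \<Rightarrow> (nat \<Rightarrow> nat \<Rightarrow> int \<Rightarrow> bool) \<Rightarrow> state \<Rightarrow> bool" where
  "entry_inv n l k R \<sigma> \<longleftrightarrow> globals n \<sigma> \<and> \<sigma> (''l'', []) = int l \<and> \<sigma> (''k'', []) = int k \<and> table_ok n R \<sigma>"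

text \<open>
  The bound \<open>100\<close> is a generous constant for two entries and two tests.
\<close>

lemma runs_table_step:
  assumes k: "k < n" and l: "l < n"
    and inv: "entry_inv n l k R \<sigma>" and s: "\<sigma> (''s'', []) = int s"
    and R: "\<And>k' l' s'. k' \<le> k \<Longrightarrow> l' \<le> l \<Longrightarrow> k' < k \<or> l' < l \<Longrightarrow> R k' l' s'"
  shows "runs table_step \<sigma> 100 (\<lambda>\<tau>. \<tau> (''s'', []) = int s \<and>
     entry_inv n l k (\<lambda>k' l' s'. R k' l' s' \<or> k' = k \<and> l' = l \<and> s' = int s) \<tau>)"
proof -
  let ?Q = "\<lambda>\<tau>. \<tau> (''s'', []) = int s \<and>
     entry_inv n l k (\<lambda>k' l' s'. R k' l' s' \<or> k' = k \<and> l' = l \<and> s' = int s) \<tau>"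
  have g: "globals n \<sigma>" and vl: "\<sigma> (''l'', []) = int l" and vk: "\<sigma> (''k'', []) = int k"
    and tab: "table_ok n R \<sigma>"
    using inv by (auto simp: entry_inv_def)
  have post: "?Q (\<sigma>((''t'', [int k, int l, int s, 0]) := v 0, (''t'', [int k, int l, int s, 1]) := v 1))"
    if "\<And>b. b < 2 \<Longrightarrow> int s + int (n * l) < int (n * n) \<Longrightarrow> v b = parity_count k l (int s) b"
    for v :: "nat \<Rightarrow> int"
    using table_ok_extend[OF tab that] g vl vk s by (simp add: entry_inv_def globals_upd)
  let ?base = "Seq (Store ''t'' [v_k, v_l, v_s, Const 0] (Const 1))
                     (Store ''t'' [v_k, v_l, v_s, Const 1] (Const 0))"
  have base: "runs ?base \<sigma> 8 ?Q" if "k = 0 \<or> l = 0"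
  proof -
    have "?Q (\<sigma>((''t'', [int k, int l, int s, 0]) := 1, (''t'', [int k, int l, int s, 1]) := 0))"
      using post[of "\<lambda>b. if b = 0 then 1 else 0"] parity_count_degenerate[OF that] by simp
    then have "runs ?base \<sigma> (4 + 4) ?Q"
      by (intro runs_Seq runs_Store) (simp_all add: vk vl s)
    then show ?thesis by simp
  qed
  have rec: "runs (Seq (table_entry 0 (Sub (Add v_k v_l) (Const 1))) (table_entry 1 (Add v_k v_l))) \<sigma> 80 ?Q"
    if pos: "k \<noteq> 0" "l \<noteq> 0"
  proof -
    obtain k' l' where kl: "k = Suc k'" "l = Suc l'" using pos by (metis not0_implies_Suc)
    define v where "v b = \<sigma> (''t'', [int k', int l, int s, int b]) + \<sigma> (''t'', [int k, int l', int s, int b]) -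
        \<sigma> (''t'', [int k', int l', int s, int b]) +
        \<sigma> (''t'', [int k', int l', int s + int l - int k - 1, \<sigma> (''par'', [int k + int l - 1 + int b])])" for b
    have v: "v b = parity_count k l (int s) b" if b: "b < 2" and fits: "int s + int (n * l) < int (n * n)" for b
    proof -
      \<comment> \<open>For \<open>b = 0, 1\<close> these are the two indices \<open>k + l - 1\<close> and \<open>k + l\<close> of the program.\<close>
      have "int k + int l - 1 + int b = int (b + k' + l' + 1)" using kl by simp
      moreover have "b + k' + l' + 1 \<le> 2 * n" using kl k l b by simp
      ultimately have par: "\<sigma> (''par'', [int k + int l - 1 + int b]) = int ((b + k' + l' + 1) mod 2)"
        using g unfolding globals_def by metis
      have entry: "\<sigma> (''t'', [int a, int c, x, int b']) = parity_count a c x b'"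
        if "a \<le> k" "c \<le> l" "a < k \<or> c < l" "x + int (n * c) < int (n * n)" "b' < 2" for a c x b'
        using tab R[of a c x] k l that unfolding table_ok_def by (meson le_less_trans)
      have n: "int (n * l) = int (n * l') + int n" using kl by simp
      then have low: "int s + int (n * l') < int (n * n)"
          "(int s + int l - int k - 1) + int (n * l') < int (n * n)"
        using fits l by linarith+
      have "v b = parity_count k' l (int s) b + parity_count k l' (int s) b - parity_count k' l' (int s) b +
          parity_count k' l' (int s + int l - int k - 1) ((b + k' + l' + 1) mod 2)"
        unfolding v_def par using kl b fits low by (simp add: entry del: of_nat_Suc of_nat_mult of_nat_add)
      moreover have "int s + int l - int k - 1 = int s + int l' - int k' - 1" using kl by simp
      ultimately show ?thesis unfolding kl using b by (simp only: parity_count_rec of_nat_0_le_iff)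
    qed
    have "runs (Seq (table_entry 0 (Sub (Add v_k v_l) (Const 1))) (table_entry 1 (Add v_k v_l))) \<sigma> (40 + 40) ?Q"
    proof (rule runs_Seq)
      have shift: "int k - 1 = int k'" "int l - 1 = int l'" "k' \<noteq> k" "l' \<noteq> l" using kl by simp_all
      have "?Q (\<sigma>((''t'', [int k, int l, int s, 0]) := v 0, (''t'', [int k, int l, int s, 1]) := v 1))"
        using post v by blast
      then have "runs (table_entry 1 (Add v_k v_l)) (\<sigma>((''t'', [int k, int l, int s, 0]) := v 0)) 40 ?Q"
        unfolding table_entry_def
        by (intro runs_Store) (simp_all add: vk vl s shift v_def)
      then show "runs (table_entry 0 (Sub (Add v_k v_l) (Const 1))) \<sigma> 40
          (\<lambda>\<tau>. runs (table_entry 1 (Add v_k v_l)) \<tau> 40 ?Q)"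
        unfolding table_entry_def[of 0]
        by - (rule runs_Store, simp_all add: vk vl s shift v_def)
    qed
    then show ?thesis by simp
  qed
  let ?rec = "Seq (table_entry 0 (Sub (Add v_k v_l) (Const 1))) (table_entry 1 (Add v_k v_l))"
  have inner: "runs (Branch (Equal v_l (Const 0)) ?base ?rec) \<sigma> (test_cost (Equal v_l (Const 0)) + 80) ?Q"
    if "k \<noteq> 0"
  proof (rule runs_Branch)
    show "runs ?base \<sigma> 80 ?Q" if "test_val (Equal v_l (Const 0)) \<sigma>"
      using that by (intro runs_mono[OF base]) (simp_all add: vl)
    show "runs ?rec \<sigma> 80 ?Q" if "\<not> test_val (Equal v_l (Const 0)) \<sigma>"
      using that \<open>k \<noteq> 0\<close> by (intro rec) (simp_all add: vl)
  qed
  have "runs table_step \<sigma> (test_cost (Equal v_k (Const 0)) + 90) ?Q"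
    unfolding table_step_def Let_def
  proof (rule runs_Branch)
    show "runs ?base \<sigma> 90 ?Q" if "test_val (Equal v_k (Const 0)) \<sigma>"
      using that by (intro runs_mono[OF base]) (simp_all add: vk)
    show "runs (Branch (Equal v_l (Const 0)) ?base ?rec) \<sigma> 90 ?Q"
      if "\<not> test_val (Equal v_k (Const 0)) \<sigma>"
      using that by (intro runs_mono[OF inner]) (simp_all add: vk)
  qed
  then show ?thesis by (rule runs_mono) auto
qed

lemma runs_s_loop:
  assumes k: "k < n" and l: "l < n"
    and inv: "entry_inv n l k (\<lambda>k' l' s'. l' < l \<or> l' = l \<and> k' < k) \<sigma>"
  shows "runs (for_loop ''s'' (Read ''m'' []) table_step) \<sigma> ((n * n + 1) * 107)
    (entry_inv n l k (\<lambda>k' l' s'. l' < l \<or> l' = l \<and> k' < Suc k))"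
proof -
  let ?R = "\<lambda>j k' l' s'. l' < l \<or> l' = l \<and> (k' < k \<or> k' = k \<and> s' < int j)"
  have "runs (for_loop ''s'' (Read ''m'' []) table_step) \<sigma>
      ((n * n + 1) * (100 + expr_cost (Read ''m'' []) + 6)) (entry_inv n l k (?R (n * n)))"
  proof (rule runs_for_loop[where I = "\<lambda>j. entry_inv n l k (?R j)"])
    have "table_ok n (?R 0) \<sigma>"
      by (rule table_ok_mono[of n "\<lambda>k' l' s'. l' < l \<or> l' = l \<and> k' < k"])
        (use inv in \<open>auto simp: entry_inv_def\<close>)
    then show "entry_inv n l k (?R 0) (\<sigma>((''s'', []) := 0))"
      using inv by (simp add: entry_inv_def globals_upd table_ok_scalar_upd)
    show "expr_val (Read ''m'' []) \<tau> = int (n * n)" if "entry_inv n l k (?R i) \<tau>" for i \<tau>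
      using that by (simp add: entry_inv_def globals_def)
    show "runs table_step \<tau> 100 (\<lambda>\<tau>'. \<tau>' (''s'', []) = int i \<and>
        entry_inv n l k (?R (Suc i)) (\<tau>'((''s'', []) := int (Suc i))))"
      if "i < n * n" "entry_inv n l k (?R i) \<tau>" "\<tau> (''s'', []) = int i" for i \<tau>
    proof (rule runs_mono[OF runs_table_step[OF k l that(2,3)]])
      fix \<tau>'
      assume "\<tau>' (''s'', []) = int i \<and>
        entry_inv n l k (\<lambda>k' l' s'. ?R i k' l' s' \<or> k' = k \<and> l' = l \<and> s' = int i) \<tau>'"
      moreover from this have "table_ok n (?R (Suc i)) \<tau>'"
        by - (rule table_ok_mono[of n "\<lambda>k' l' s'. ?R i k' l' s' \<or> k' = k \<and> l' = l \<and> s' = int i"], auto simp: entry_inv_def)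
      ultimately show "\<tau>' (''s'', []) = int i \<and>
          entry_inv n l k (?R (Suc i)) (\<tau>'((''s'', []) := int (Suc i)))"
        by (simp add: entry_inv_def globals_upd table_ok_scalar_upd)
    qed auto
  qed
  then show ?thesis
  proof (rule runs_mono)
    fix \<tau> assume "entry_inv n l k (?R (n * n)) \<tau>"
    moreover from this have "table_ok n (\<lambda>k' l' s'. l' < l \<or> l' = l \<and> k' < Suc k) \<tau>"
      by - (rule table_ok_mono[of n "?R (n * n)"], auto simp: entry_inv_def)
    ultimately show "entry_inv n l k (\<lambda>k' l' s'. l' < l \<or> l' = l \<and> k' < Suc k) \<tau>"
      by (simp add: entry_inv_def)
  qed simp
qed

definition row_inv :: "nat \<Rightarrow> nat \<Rightarrow> nat \<Rightarrow> state \<Rightarrow> bool" where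
  "row_inv n l k \<sigma> \<longleftrightarrow> globals n \<sigma> \<and> \<sigma> (''l'', []) = int l \<and>
     table_ok n (\<lambda>k' l' s'. l' < l \<or> l' = l \<and> k' < k) \<sigma>"

lemma runs_k_loop:
  assumes l: "l < n" and inv: "row_inv n l 0 \<sigma>"
  shows "runs (for_loop ''k'' v_n (for_loop ''s'' (Read ''m'' []) table_step)) \<sigma>
    ((n + 1) * ((n * n + 1) * 107 + expr_cost v_n + 6)) (row_inv n l n)"
proof (rule runs_for_loop[where I = "row_inv n l"])
  show "row_inv n l 0 (\<sigma>((''k'', []) := 0))"
    using inv by (simp add: row_inv_def globals_upd table_ok_scalar_upd)
  show "expr_val v_n \<tau> = int n" if "row_inv n l i \<tau>" for i \<tau>
    using that by (simp add: row_inv_def globals_def)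
  show "runs (for_loop ''s'' (Read ''m'' []) table_step) \<tau> ((n * n + 1) * 107)
      (\<lambda>\<tau>'. \<tau>' (''k'', []) = int i \<and> row_inv n l (Suc i) (\<tau>'((''k'', []) := int (Suc i))))"
    if "i < n" "row_inv n l i \<tau>" "\<tau> (''k'', []) = int i" for i \<tau>
  proof -
    have "entry_inv n l i (\<lambda>k' l' s'. l' < l \<or> l' = l \<and> k' < i) \<tau>"
      using that by (simp add: row_inv_def entry_inv_def)
    from runs_s_loop[OF that(1) l this] show ?thesis
      by (rule runs_mono) (simp_all add: row_inv_def entry_inv_def globals_upd table_ok_scalar_upd)
  qed
qed

lemma runs_table_loop:
  assumes "globals n \<sigma>" and zero: "\<And>ks. \<sigma> (''t'', ks) = 0"
  shows "runs table_loop \<sigma> ((n + 1) * ((n + 1) * ((n * n + 1) * 107 + expr_cost v_n + 6) + expr_cost v_n + 6))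
    (\<lambda>\<tau>. globals n \<tau> \<and> table_ok n (\<lambda>k l s. l < n) \<tau>)"
  unfolding table_loop_def
proof (rule runs_for_loop[where I = "\<lambda>j \<tau>. globals n \<tau> \<and> table_ok n (\<lambda>k l s. l < j) \<tau>"])
  let ?I = "\<lambda>j \<tau>. globals n \<tau> \<and> table_ok n (\<lambda>k l s. l < j) \<tau>"
  show "?I 0 (\<sigma>((''l'', []) := 0))"
    using assms by (simp add: globals_upd table_ok_scalar_upd) (simp add: table_ok_def parity_count_neg)
  show "expr_val v_n \<tau> = int n" if "?I i \<tau>" for i \<tau>
    using that by (simp add: globals_def)
  show "runs (for_loop ''k'' v_n (for_loop ''s'' (Read ''m'' []) table_step)) \<tau>
      ((n + 1) * ((n * n + 1) * 107 + expr_cost v_n + 6))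
      (\<lambda>\<tau>'. \<tau>' (''l'', []) = int i \<and> ?I (Suc i) (\<tau>'((''l'', []) := int (Suc i))))"
    if "i < n" "?I i \<tau>" "\<tau> (''l'', []) = int i" for i \<tau>
  proof -
    have "row_inv n i 0 \<tau>" using that by (simp add: row_inv_def)
    from runs_k_loop[OF that(1) this] show ?thesis
    proof (rule runs_mono)
      fix \<tau>' assume "row_inv n i n \<tau>'"
      moreover from this have "table_ok n (\<lambda>k l s. l < Suc i) \<tau>'"
        by - (rule table_ok_mono[of n "\<lambda>k' l' s'. l' < i \<or> l' = i \<and> k' < n"], auto simp: row_inv_def)
      ultimately show "\<tau>' (''l'', []) = int i \<and> ?I (Suc i) (\<tau>'((''l'', []) := int (Suc i)))"
        by (simp add: row_inv_def globals_upd table_ok_scalar_upd)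
    qed simp
  qed
qed

lemma runs_sum_loop:
  assumes g: "globals n \<sigma>" and tab: "table_ok n (\<lambda>k l s. l < n) \<sigma>" and n: "n = Suc m"
  shows "runs sum_loop \<sigma> ((n + 1) * (20 + expr_cost v_n + 6))
    (\<lambda>\<tau>. \<tau> (''out'', []) = int (card (D n)))"
proof -
  let ?f = "\<lambda>k. parity_count k m (int m - int k - 1) ((k + m + 1) mod 2)"
  let ?I = "\<lambda>j \<tau>. globals n (\<tau>((''out'', []) := 0)) \<and> table_ok n (\<lambda>k l s. l < n) \<tau> \<and>
    \<tau> (''out'', []) = (\<Sum>k<j. ?f k)"
  have "runs sum_loop \<sigma> ((n + 1) * (20 + expr_cost v_n + 6)) (?I n)"
    unfolding sum_loop_def
  proof (rule runs_for_loop[where I = "?I"])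
    show "?I 0 (\<sigma>((''k'', []) := 0))" using g tab
      by (simp add: globals_def table_ok_scalar_upd)
    show "expr_val v_n \<tau> = int n" if "?I i \<tau>" for i \<tau>
      using that by (simp add: globals_def)
    show "runs (Store ''out'' [] (Add (Read ''out'' [])
       (Read ''t'' [v_k, Sub v_n (Const 1), Sub (Sub v_n v_k) (Const 2), Read ''par'' [Add v_k v_n]]))) \<tau> 20
       (\<lambda>\<tau>'. \<tau>' (''k'', []) = int i \<and> ?I (Suc i) (\<tau>'((''k'', []) := int (Suc i))))"
      if i: "i < n" and I: "?I i \<tau>" and k: "\<tau> (''k'', []) = int i" for i \<tau>
    proof (rule runs_Store)
      have gl: "\<tau> (''in'', []) = int n" "\<And>j. j \<le> 2 * n \<Longrightarrow> \<tau> (''par'', [int j]) = int (j mod 2)"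
        using I by (auto simp: globals_def)
      have "\<tau> (''par'', [int i + int n]) = int ((i + m + 1) mod 2)"
      proof -
        have "int i + int n = int (i + m + 1)" "i + m + 1 \<le> 2 * n" using n i by simp_all
        then show ?thesis using gl(2) by metis
      qed
      moreover have "\<tau> (''t'', [int i, int m, int m - int i - 1, int ((i + m + 1) mod 2)]) = ?f i"
      proof -
        have "int (n * n) = int (n * m) + int n" using n by simp
        then have "(int m - int i - 1) + int (n * m) < int (n * n)" using n by linarith
        then show ?thesis using I i n unfolding table_ok_def by simp
      qed
      moreover have "int n - 1 = int m" "int n - int i - 2 = int m - int i - 1" using n by simp_all
      ultimately have val: "expr_val (Read ''t'' [v_k, Sub v_n (Const 1), Sub (Sub v_n v_k) (Const 2),
          Read ''par'' [Add v_k v_n]]) \<tau> = ?f i"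
        by (simp only: expr_val.simps list.map k gl(1))
      let ?\<tau> = "\<tau>((''out'', []) := (\<Sum>k<Suc i. ?f k))"
      have "?I (Suc i) (?\<tau>((''k'', []) := int (Suc i)))" using I
        by (simp add: globals_def table_ok_scalar_upd)
      moreover have "\<tau>((''out'', map (\<lambda>e. expr_val e \<tau>) []) := expr_val (Add (Read ''out'' [])
          (Read ''t'' [v_k, Sub v_n (Const 1), Sub (Sub v_n v_k) (Const 2), Read ''par'' [Add v_k v_n]])) \<tau>)
          = ?\<tau>"
        unfolding expr_val.simps(3) val using I by simp
      ultimately show "(\<lambda>\<tau>'. \<tau>' (''k'', []) = int i \<and> ?I (Suc i) (\<tau>'((''k'', []) := int (Suc i))))
          (\<tau>((''out'', map (\<lambda>e. expr_val e \<tau>) []) := expr_val (Add (Read ''out'' [])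
          (Read ''t'' [v_k, Sub v_n (Const 1), Sub (Sub v_n v_k) (Const 2), Read ''par'' [Add v_k v_n]])) \<tau>))"
        using k by (simp only:) simp
    qed simp
  qed
  then show ?thesis
  proof (rule runs_mono)
    fix \<tau> assume "?I n \<tau>"
    moreover have "(\<Sum>k<n. ?f k) = int (card (D n))"
      using n by (simp add: card_D_parity_count parity_count_neg)
    ultimately show "\<tau> (''out'', []) = int (card (D n))" by simp
  qed simp
qed

lemma runs_setup:
  "runs (Seq par_loop square_loop) (input_state n) ((2 * n + 1) * 15 + (n + 1) * 11)
    (\<lambda>\<tau>. globals n \<tau> \<and> (\<forall>ks. \<tau> (''t'', ks) = 0))"
proof (rule runs_Seq)
  let ?I = "\<lambda>j \<tau>. \<tau> (''in'', []) = int n \<and> \<tau> (''m'', []) = 0 \<and> \<tau> (''out'', []) = 0 \<and>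
    (\<forall>i\<le>j. \<tau> (''par'', [int i]) = int (i mod 2)) \<and> (\<forall>ks. \<tau> (''t'', ks) = 0)"
  let ?J = "\<lambda>j \<tau>. \<tau> (''in'', []) = int n \<and> \<tau> (''m'', []) = int (j * n) \<and> \<tau> (''out'', []) = 0 \<and>
    (\<forall>i\<le>2 * n. \<tau> (''par'', [int i]) = int (i mod 2)) \<and> (\<forall>ks. \<tau> (''t'', ks) = 0)"
  have "runs par_loop (input_state n) ((2 * n + 1) * (6 + expr_cost (Add v_n v_n) + 6)) (?I (2 * n))"
    unfolding par_loop_def
  proof (rule runs_for_loop[where I = "?I"])
    show "?I 0 ((input_state n)((''i'', []) := 0))" by (simp add: input_state_def)
    show "expr_val (Add v_n v_n) \<tau> = int (2 * n)" if "?I i \<tau>" for i \<tau>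
      using that by simp
    show "runs (Store ''par'' [Add (Read ''i'' []) (Const 1)] (Sub (Const 1) (Read ''par'' [Read ''i'' []]))) \<tau> 6
        (\<lambda>\<tau>'. \<tau>' (''i'', []) = int j \<and> ?I (Suc j) (\<tau>'((''i'', []) := int (Suc j))))"
      if "?I j \<tau>" "\<tau> (''i'', []) = int j" for j \<tau>
    proof -
      have "1 - int (j mod 2) = int (Suc j mod 2)" by (simp add: mod_Suc)
      then show ?thesis using that by (intro runs_Store) (auto simp: le_Suc_eq add.commute)
    qed
  qed
  then show "runs par_loop (input_state n) ((2 * n + 1) * 15)
      (\<lambda>\<tau>. runs square_loop \<tau> ((n + 1) * 11) (\<lambda>\<tau>. globals n \<tau> \<and> (\<forall>ks. \<tau> (''t'', ks) = 0)))"
  proof (rule runs_mono)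
    fix \<tau> assume I: "?I (2 * n) \<tau>"
    have "runs square_loop \<tau> ((n + 1) * (4 + expr_cost v_n + 6)) (?J n)"
      unfolding square_loop_def
    proof (rule runs_for_loop[where I = ?J])
      show "?J 0 (\<tau>((''i'', []) := 0))" using I by simp
      show "expr_val v_n \<tau>' = int n" if "?J j \<tau>'" for j \<tau>'
        using that by simp
      show "runs (Store ''m'' [] (Add (Read ''m'' []) v_n)) \<tau>' 4
          (\<lambda>\<tau>''. \<tau>'' (''i'', []) = int j \<and> ?J (Suc j) (\<tau>''((''i'', []) := int (Suc j))))"
        if "?J j \<tau>'" "\<tau>' (''i'', []) = int j" for j \<tau>'
        using that by (intro runs_Store) (auto simp: algebra_simps)
    qed
    then show "runs square_loop \<tau> ((n + 1) * 11) (\<lambda>\<tau>. globals n \<tau> \<and> (\<forall>ks. \<tau> (''t'', ks) = 0))"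
      by (rule runs_mono) (auto simp: globals_def)
  qed simp
qed

lemma runs_count_D:
  assumes "n \<ge> 1"
  shows "runs count_D (input_state n) (2000 * n ^ 4) (\<lambda>\<tau>. \<tau> (''out'', []) = int (card (D n)))"
proof -
  obtain m where n: "n = Suc m" using assms by (cases n) auto
  let ?A = "(2 * n + 1) * 15 + (n + 1) * 11"
  let ?B = "(n + 1) * ((n + 1) * ((n * n + 1) * 107 + expr_cost v_n + 6) + expr_cost v_n + 6)"
  let ?C = "(n + 1) * (20 + expr_cost v_n + 6)"
  have "runs count_D (input_state n) (?A + (?B + ?C)) (\<lambda>\<tau>. \<tau> (''out'', []) = int (card (D n)))"
    unfolding count_D_def
  proof (rule runs_Seq, rule runs_mono[OF runs_setup order_refl])
    fix \<sigma> assume "globals n \<sigma> \<and> (\<forall>ks. \<sigma> (''t'', ks) = 0)"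
    then have "runs table_loop \<sigma> ?B (\<lambda>\<tau>. globals n \<tau> \<and> table_ok n (\<lambda>k l s. l < n) \<tau>)"
      using runs_table_loop by blast
    then show "runs (Seq table_loop sum_loop) \<sigma> (?B + ?C) (\<lambda>\<tau>. \<tau> (''out'', []) = int (card (D n)))"
      using runs_sum_loop[OF _ _ n] by (intro runs_Seq) (auto elim: runs_mono)
  qed
  moreover have "?A + (?B + ?C) \<le> 2000 * n ^ 4"
  proof -
    have p: "n ^ 0 \<le> n ^ 4" "n ^ 1 \<le> n ^ 4" "n ^ 2 \<le> n ^ 4" "n ^ 3 \<le> n ^ 4"
      by (rule power_increasing[OF _ assms], simp)+
    have "?A + (?B + ?C) = 107 * n ^ 4 + 214 * n ^ 3 + 221 * n ^ 2 + 303 * n + 174"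
      by (simp add: algebra_simps power4_eq_xxxx power3_eq_cube power2_eq_square)
    also have "\<dots> \<le> 2000 * n ^ 4"
      using p unfolding power_0 power_one_right by linarith
    finally show ?thesis .
  qed
  ultimately show ?thesis by (rule runs_mono)
qed

theorem count_D_computes:
  "computes_within count_D (\<lambda>n. card (D n)) (\<lambda>n. 2000 * n ^ 4) (\<lambda>n. 2000 * n ^ 4)"
  unfolding computes_within_def
proof (intro allI impI)
  fix n :: nat assume "n \<ge> 1"
  from runs_count_D[OF this] obtain t F \<tau> where
    r: "exec count_D (input_state n) t F \<tau>" "t \<le> 2000 * n ^ 4" "\<tau> (''out'', []) = int (card (D n))"
    unfolding runs_def by blast
  then have "card F \<le> 2000 * n ^ 4" using exec_space_le_time[OF r(1)] by simp
  then show "\<exists>t F \<tau>. exec count_D (input_state n) t F \<tau> \<and> \<tau> (''out'', []) = int (card (D n)) \<and>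
      t \<le> 2000 * n ^ 4 \<and> card F \<le> 2000 * n ^ 4"
    using r by blast
qed

theorem mainTheorem1:
  shows "(\<forall>n::nat. n \<ge> 1 \<longrightarrow>
            card (D n) =
              (\<Sum>N\<in>I_even n. \<Sum>k=1..int n - 1.
                 card (Ps (N - k - int n + 1) (k - 1) (int n - 1) (int n - k - 1)))) \<and>
         (\<exists>p T S. computes_within p (\<lambda>n. card (D n)) T S \<and>
            (\<lambda>n. real (T n)) \<in> O(\<lambda>n. real n ^ 5) \<and>
            (\<lambda>n. real (S n)) \<in> O(\<lambda>n. real n ^ 5))"
proof
  have "(\<lambda>n. real (2000 * n ^ 4)) \<in> O(\<lambda>n. real n ^ 5)"
  proof (rule bigoI[where c = 2000])
    have "real n ^ 4 \<le> real n ^ 5" if "n \<ge> 1" for n :: nat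
      using that by (intro power_increasing) auto
    then show "\<forall>\<^sub>F n in sequentially. norm (real (2000 * n ^ 4)) \<le> 2000 * norm (real n ^ 5)"
      by (intro eventually_sequentiallyI[of 1]) simp
  qed
  then show "\<exists>p T S. computes_within p (\<lambda>n. card (D n)) T S \<and>
      (\<lambda>n. real (T n)) \<in> O(\<lambda>n. real n ^ 5) \<and> (\<lambda>n. real (S n)) \<in> O(\<lambda>n. real n ^ 5)"
    using count_D_computes by blast
qed (use card_D_Ps in blast)

end
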